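(* Let $P:\mathbb{C}^{\mathrm{op}}\to\mathbf{Pos}$ be a bounded existential implicational doctrine, with non-trivial fibers (no $P(A)$ is a singleton) and with a small base category $\mathbb{C}$. Then there exists a bounded existential implicational model of $P$ in the doctrine of subsets $\mathscr{P}_*:\mathrm{Set}_*^{\mathrm{op}}\to\mathbf{Pos}$, i.e. a bounded existential implicational doctrine morphism $P\to\mathscr{P}_*$.
   Context: **Doctrines.** $\mathbf{Pos}$ is the category of posets and monotone maps. A doctrine is a functor $P:\mathbb{C}^{\mathrm{op}}\to\mathbf{Pos}$ where $\mathbb{C}$ (the base category) has finite products; the posets $P(A)$ are its fibers, the maps $P(f)$ its reindexings. $P$ is primary if every $P(A)$ has finite meets (including $\top$), preserved by reindexings. $P$ is implicational if every $P(A)$ has finite meets and a Heyting implication $\to$ (i.e. is cartesian closed), all preserved by reindexings. $P$ is bounded if every $P(A)$ has top and bottom elements preserved by reindexings. A primary doctrine $P$ is existential if for all objects $B,C$ the map $P(\mathrm{pr}_1):P(C)\to P(C\times B)$ has a left adjoint $\exists^B_C$ satisfying Beck–Chevalley ($\exists^B_C P(f\times \mathrm{id}_B)=P(f)\exists^B_{C'}$ for all $f:C\to C'$) and Frobenius reciprocity ($\exists^B_C(\alpha\wedge P(\mathrm{pr}_1)\beta)=\exists^B_C(\alpha)\wedge\beta$). **Morphisms.** A doctrine morphism (also called a model of $P$ in $R$) $(F,\mathfrak{f})$ from $P:\mathbb{C}^{\mathrm{op}}\to\mathbf{Pos}$ to $R:\mathbb{D}^{\mathrm{op}}\to\mathbf{Pos}$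 consists of a functor $F:\mathbb{C}\to\mathbb{D}$ preserving finite products and a natural transformation $\mathfrak{f}:P\to R\circ F^{\mathrm{op}}$. It is bounded/implicational/existential if both $P$ and $R$ are and $\mathfrak{f}$ preserves the corresponding structure (top and bottom; finite meets and implication; finite meets and existential quantifiers). **Subsets doctrine.** $\mathrm{Set}_*$ is the category of non-empty sets and functions, and $\mathscr{P}_*:\mathrm{Set}_*^{\mathrm{op}}\to\mathbf{Pos}$ sends a set to its powerset ordered by inclusion and a function to its inverse-image map. (Its existential quantifier is direct image along projections.) *)

theory Defs
  imports
    "HOL-Algebra.Galois_Connection"
    "HOL-Library.Equipollence"
    "HOL-Library.FuncSet"
begin

section \<open>Categories with finite products\<close>

record ('o, 'a) cat =
  Obj :: "'o set"
  Arr :: "'a set"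
  Dom :: "'a \<Rightarrow> 'o"
  Cod :: "'a \<Rightarrow> 'o"
  Ide :: "'o \<Rightarrow> 'a"
  Comp :: "'a \<Rightarrow> 'a \<Rightarrow> 'a"  \<comment> \<open>\<open>Comp C g f\<close> is \<open>g\<close> after \<open>f\<close>\<close>

definition Hom :: "('o, 'a) cat \<Rightarrow> 'o \<Rightarrow> 'o \<Rightarrow> 'a set" where
  "Hom C A B = {f \<in> Arr C. Dom C f = A \<and> Cod C f = B}"

locale category =
  fixes C :: "('o, 'a) cat"
  assumes Dom_Obj: "f \<in> Arr C \<Longrightarrow> Dom C f \<in> Obj C"
    and Cod_Obj: "f \<in> Arr C \<Longrightarrow> Cod C f \<in> Obj C"
    and Ide_Hom: "A \<in> Obj C \<Longrightarrow> Ide C A \<in> Hom C A A"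
    and Comp_Hom: "f \<in> Hom C A B \<Longrightarrow> g \<in> Hom C B D \<Longrightarrow> Comp C g f \<in> Hom C A D"
    and Comp_Ide_right: "f \<in> Hom C A B \<Longrightarrow> Comp C f (Ide C A) = f"
    and Comp_Ide_left: "f \<in> Hom C A B \<Longrightarrow> Comp C (Ide C B) f = f"
    and Comp_assoc: "f \<in> Hom C A B \<Longrightarrow> g \<in> Hom C B D \<Longrightarrow> h \<in> Hom C D E
      \<Longrightarrow> Comp C h (Comp C g f) = Comp C (Comp C h g) f"

definition is_terminal :: "('o, 'a) cat \<Rightarrow> 'o \<Rightarrow> bool" where
  "is_terminal C T \<longleftrightarrow> T \<in> Obj C \<and> (\<forall>A\<in>Obj C. \<exists>!f. f \<in> Hom C A T)"

text \<open>\<open>is_product C X A B p q\<close>: the cone \<open>p : X \<rightarrow> A\<close>, \<open>q : X \<rightarrow> B\<close> is a product of \<open>A\<close> and \<open>B\<close>.\<close>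

definition is_product :: "('o, 'a) cat \<Rightarrow> 'o \<Rightarrow> 'o \<Rightarrow> 'o \<Rightarrow> 'a \<Rightarrow> 'a \<Rightarrow> bool" where
  "is_product C X A B p q \<longleftrightarrow>
     p \<in> Hom C X A \<and> q \<in> Hom C X B \<and>
     (\<forall>Y\<in>Obj C. \<forall>f\<in>Hom C Y A. \<forall>g\<in>Hom C Y B.
        \<exists>!h. h \<in> Hom C Y X \<and> Comp C p h = f \<and> Comp C q h = g)"

locale finite_product_category = category C for C :: "('o, 'a) cat" +
  assumes terminal_exists: "\<exists>T. is_terminal C T"
    and product_exists: "A \<in> Obj C \<Longrightarrow> B \<in> Obj C \<Longrightarrow> \<exists>X p q. is_product C X A B p q"

locale product_functor =
  source: finite_product_category C + target: finite_product_category D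
  for C :: "('o, 'a) cat" and D :: "('o2, 'a2) cat" +
  fixes Fo :: "'o \<Rightarrow> 'o2" and Fa :: "'a \<Rightarrow> 'a2"
  assumes Fo_Obj: "A \<in> Obj C \<Longrightarrow> Fo A \<in> Obj D"
    and Fa_Hom: "f \<in> Hom C A B \<Longrightarrow> Fa f \<in> Hom D (Fo A) (Fo B)"
    and Fa_Ide: "A \<in> Obj C \<Longrightarrow> Fa (Ide C A) = Ide D (Fo A)"
    and Fa_Comp: "f \<in> Hom C A B \<Longrightarrow> g \<in> Hom C B E
      \<Longrightarrow> Fa (Comp C g f) = Comp D (Fa g) (Fa f)"
    and preserves_terminal: "is_terminal C T \<Longrightarrow> is_terminal D (Fo T)"
    and preserves_product: "is_product C X A B p q
      \<Longrightarrow> is_product D (Fo X) (Fo A) (Fo B) (Fa p) (Fa q)"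


section \<open>Doctrines\<close>

record ('o, 'a, 'p) doctrine =
  Base :: "('o, 'a) cat"
  Fib :: "'o \<Rightarrow> 'p gorder"
  Reidx :: "'a \<Rightarrow> 'p \<Rightarrow> 'p"

locale doctrine =
  fixes P :: "('o, 'a, 'p) doctrine"
  assumes base: "finite_product_category (Base P)"
    and fibre: "A \<in> Obj (Base P) \<Longrightarrow> partial_order (Fib P A)"
    and Reidx_closed: "f \<in> Hom (Base P) A B
      \<Longrightarrow> Reidx P f \<in> carrier (Fib P B) \<rightarrow> carrier (Fib P A)"
    and Reidx_mono: "f \<in> Hom (Base P) A B \<Longrightarrow> isotone (Fib P B) (Fib P A) (Reidx P f)"
    and Reidx_Ide: "A \<in> Obj (Base P) \<Longrightarrow> \<alpha> \<in> carrier (Fib P A)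
      \<Longrightarrow> Reidx P (Ide (Base P) A) \<alpha> = \<alpha>"
    and Reidx_Comp: "f \<in> Hom (Base P) A B \<Longrightarrow> g \<in> Hom (Base P) B D
      \<Longrightarrow> \<alpha> \<in> carrier (Fib P D)
      \<Longrightarrow> Reidx P (Comp (Base P) g f) \<alpha> = Reidx P f (Reidx P g \<alpha>)"

locale primary_doctrine = doctrine P for P :: "('o, 'a, 'p) doctrine" +
  assumes fibre_meets: "A \<in> Obj (Base P) \<Longrightarrow> lower_semilattice (Fib P A)"
    and fibre_top: "A \<in> Obj (Base P) \<Longrightarrow> weak_partial_order_top (Fib P A)"
    and Reidx_meet: "f \<in> Hom (Base P) A B
      \<Longrightarrow> \<alpha> \<in> carrier (Fib P B) \<Longrightarrow> \<beta> \<in> carrier (Fib P B)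
      \<Longrightarrow> Reidx P f (\<alpha> \<sqinter>\<^bsub>Fib P B\<^esub> \<beta>) = Reidx P f \<alpha> \<sqinter>\<^bsub>Fib P A\<^esub> Reidx P f \<beta>"
    and Reidx_top: "f \<in> Hom (Base P) A B \<Longrightarrow> Reidx P f \<top>\<^bsub>Fib P B\<^esub> = \<top>\<^bsub>Fib P A\<^esub>"

locale bounded_doctrine = doctrine P for P :: "('o, 'a, 'p) doctrine" +
  assumes fibre_top: "A \<in> Obj (Base P) \<Longrightarrow> weak_partial_order_top (Fib P A)"
    and fibre_bottom: "A \<in> Obj (Base P) \<Longrightarrow> weak_partial_order_bottom (Fib P A)"
    and Reidx_top: "f \<in> Hom (Base P) A B \<Longrightarrow> Reidx P f \<top>\<^bsub>Fib P B\<^esub> = \<top>\<^bsub>Fib P A\<^esub>"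
    and Reidx_bottom: "f \<in> Hom (Base P) A B \<Longrightarrow> Reidx P f \<bottom>\<^bsub>Fib P B\<^esub> = \<bottom>\<^bsub>Fib P A\<^esub>"

definition is_himp :: "'p gorder \<Rightarrow> 'p \<Rightarrow> 'p \<Rightarrow> 'p \<Rightarrow> bool" where
  "is_himp L \<alpha> \<beta> \<iota> \<longleftrightarrow> \<iota> \<in> carrier L \<and>
     (\<forall>\<gamma>\<in>carrier L. \<gamma> \<sqsubseteq>\<^bsub>L\<^esub> \<iota> \<longleftrightarrow> \<gamma> \<sqinter>\<^bsub>L\<^esub> \<alpha> \<sqsubseteq>\<^bsub>L\<^esub> \<beta>)"

definition himp :: "'p gorder \<Rightarrow> 'p \<Rightarrow> 'p \<Rightarrow> 'p" where
  "himp L \<alpha> \<beta> = (SOME \<iota>. is_himp L \<alpha> \<beta> \<iota>)"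

locale implicational_doctrine = primary_doctrine P for P :: "('o, 'a, 'p) doctrine" +
  assumes himp_exists: "A \<in> Obj (Base P) \<Longrightarrow> \<alpha> \<in> carrier (Fib P A) \<Longrightarrow> \<beta> \<in> carrier (Fib P A)
      \<Longrightarrow> \<exists>\<iota>. is_himp (Fib P A) \<alpha> \<beta> \<iota>"
    and Reidx_himp: "f \<in> Hom (Base P) A B
      \<Longrightarrow> \<alpha> \<in> carrier (Fib P B) \<Longrightarrow> \<beta> \<in> carrier (Fib P B)
      \<Longrightarrow> Reidx P f (himp (Fib P B) \<alpha> \<beta>) = himp (Fib P A) (Reidx P f \<alpha>) (Reidx P f \<beta>)"

definition is_left_adjoint :: "('o, 'a, 'p) doctrine \<Rightarrow> 'a \<Rightarrow> ('p \<Rightarrow> 'p) \<Rightarrow> bool" where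
  "is_left_adjoint P f E \<longleftrightarrow> galois_connection
     \<lparr>orderA = Fib P (Dom (Base P) f), orderB = Fib P (Cod (Base P) f),
      lower = E, upper = Reidx P f\<rparr>"

text \<open>A left adjoint is determined on the fibre over the domain of \<open>f\<close>; its values elsewhere are
  junk, so \<open>ex P f\<close> is only meaningful on that fibre.\<close>

definition ex :: "('o, 'a, 'p) doctrine \<Rightarrow> 'a \<Rightarrow> 'p \<Rightarrow> 'p" where
  "ex P f = (SOME E. is_left_adjoint P f E)"

text \<open>Finite products are not chosen: the quantifier along the first projection \<open>p : X \<rightarrow> C\<close> is
  required for every product cone. In the Beck--Chevalley condition, \<open>h\<close> is the arrow
  \<open>f \<times> id\<close> between two such cones.\<close>

locale existential_doctrine = primary_doctrine P for P :: "('o, 'a, 'p) doctrine" +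
  assumes left_adjoint_exists: "is_product (Base P) X C B p q \<Longrightarrow> \<exists>E. is_left_adjoint P p E"
    and Beck_Chevalley: "is_product (Base P) X C B p q \<Longrightarrow> is_product (Base P) X' C' B p' q'
      \<Longrightarrow> f \<in> Hom (Base P) C C' \<Longrightarrow> h \<in> Hom (Base P) X X'
      \<Longrightarrow> Comp (Base P) p' h = Comp (Base P) f p \<Longrightarrow> Comp (Base P) q' h = q
      \<Longrightarrow> \<alpha> \<in> carrier (Fib P X')
      \<Longrightarrow> ex P p (Reidx P h \<alpha>) = Reidx P f (ex P p' \<alpha>)"
    and Frobenius: "is_product (Base P) X C B p q
      \<Longrightarrow> \<alpha> \<in> carrier (Fib P X) \<Longrightarrow> \<beta> \<in> carrier (Fib P C)
      \<Longrightarrow> ex P p (\<alpha> \<sqinter>\<^bsub>Fib P X\<^esub> Reidx P p \<beta>) = ex P p \<alpha> \<sqinter>\<^bsub>Fib P C\<^esub> \<beta>"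


section \<open>Doctrine morphisms\<close>

record ('o, 'a, 'p, 'o2, 'a2, 'p2) morphism =
  ObjMap :: "'o \<Rightarrow> 'o2"
  ArrMap :: "'a \<Rightarrow> 'a2"
  FibMap :: "'o \<Rightarrow> 'p \<Rightarrow> 'p2"

locale doctrine_morphism =
  source: doctrine P + target: doctrine R
  for P :: "('o, 'a, 'p) doctrine" and R :: "('o2, 'a2, 'p2) doctrine" +
  fixes M :: "('o, 'a, 'p, 'o2, 'a2, 'p2) morphism"
  assumes maps: "product_functor (Base P) (Base R) (ObjMap M) (ArrMap M)"
    and FibMap_closed: "A \<in> Obj (Base P)
      \<Longrightarrow> FibMap M A \<in> carrier (Fib P A) \<rightarrow> carrier (Fib R (ObjMap M A))"
    and FibMap_mono: "A \<in> Obj (Base P)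
      \<Longrightarrow> isotone (Fib P A) (Fib R (ObjMap M A)) (FibMap M A)"
    and FibMap_natural: "f \<in> Hom (Base P) A B \<Longrightarrow> \<alpha> \<in> carrier (Fib P B)
      \<Longrightarrow> FibMap M A (Reidx P f \<alpha>) = Reidx R (ArrMap M f) (FibMap M B \<alpha>)"

locale bounded_morphism =
  doctrine_morphism P R M + source: bounded_doctrine P + target: bounded_doctrine R
  for P :: "('o, 'a, 'p) doctrine" and R :: "('o2, 'a2, 'p2) doctrine" and M +
  assumes FibMap_top: "A \<in> Obj (Base P)
      \<Longrightarrow> FibMap M A \<top>\<^bsub>Fib P A\<^esub> = \<top>\<^bsub>Fib R (ObjMap M A)\<^esub>"
    and FibMap_bottom: "A \<in> Obj (Base P)
      \<Longrightarrow> FibMap M A \<bottom>\<^bsub>Fib P A\<^esub> = \<bottom>\<^bsub>Fib R (ObjMap M A)\<^esub>"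

locale primary_morphism =
  doctrine_morphism P R M + source: primary_doctrine P + target: primary_doctrine R
  for P :: "('o, 'a, 'p) doctrine" and R :: "('o2, 'a2, 'p2) doctrine" and M +
  assumes FibMap_top: "A \<in> Obj (Base P)
      \<Longrightarrow> FibMap M A \<top>\<^bsub>Fib P A\<^esub> = \<top>\<^bsub>Fib R (ObjMap M A)\<^esub>"
    and FibMap_meet: "A \<in> Obj (Base P)
      \<Longrightarrow> \<alpha> \<in> carrier (Fib P A) \<Longrightarrow> \<beta> \<in> carrier (Fib P A)
      \<Longrightarrow> FibMap M A (\<alpha> \<sqinter>\<^bsub>Fib P A\<^esub> \<beta>)
        = FibMap M A \<alpha> \<sqinter>\<^bsub>Fib R (ObjMap M A)\<^esub> FibMap M A \<beta>"

locale implicational_morphism =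
  primary_morphism P R M + source: implicational_doctrine P + target: implicational_doctrine R
  for P :: "('o, 'a, 'p) doctrine" and R :: "('o2, 'a2, 'p2) doctrine" and M +
  assumes FibMap_himp: "A \<in> Obj (Base P)
      \<Longrightarrow> \<alpha> \<in> carrier (Fib P A) \<Longrightarrow> \<beta> \<in> carrier (Fib P A)
      \<Longrightarrow> FibMap M A (himp (Fib P A) \<alpha> \<beta>)
        = himp (Fib R (ObjMap M A)) (FibMap M A \<alpha>) (FibMap M A \<beta>)"

text \<open>Since the functor preserves product cones, \<open>ArrMap M p\<close> is again a first projection.\<close>

locale existential_morphism =
  primary_morphism P R M + source: existential_doctrine P + target: existential_doctrine R
  for P :: "('o, 'a, 'p) doctrine" and R :: "('o2, 'a2, 'p2) doctrine" and M +
  assumes FibMap_ex: "is_product (Base P) X C B p q \<Longrightarrow> \<alpha> \<in> carrier (Fib P X)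
      \<Longrightarrow> FibMap M C (ex P p \<alpha>) = ex R (ArrMap M p) (FibMap M X \<alpha>)"


section \<open>The doctrine of subsets\<close>

text \<open>The sets are the subsets of a type \<open>'u\<close>, which plays the role of the universe. For \<open>Set_star\<close>
  to have binary products, \<open>'u\<close> must contain a copy of its own square; every infinite type does.
  A set is small if it injects into \<open>'u\<close>, that is, if it is in bijection with a set of the
  universe. An arrow is a triple of domain, graph (a function extensional on the domain) and
  codomain.\<close>

type_synonym 'u set_arrow = "'u set \<times> ('u \<Rightarrow> 'u) \<times> 'u set"

definition Set_star :: "('u set, 'u set_arrow) cat" where
  "Set_star = \<lparr>
     Obj = {A. A \<noteq> {}},
     Arr = {(A, f, B). A \<noteq> {} \<and> B \<noteq> {} \<and> f \<in> A \<rightarrow>\<^sub>E B},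
     Dom = (\<lambda>(A, f, B). A),
     Cod = (\<lambda>(A, f, B). B),
     Ide = (\<lambda>A. (A, restrict id A, A)),
     Comp = (\<lambda>(B, g, D) (A, f, B'). (A, compose A g f, D))\<rparr>"

definition subsets_doctrine :: "('u set, 'u set_arrow, 'u set) doctrine" where
  "subsets_doctrine = \<lparr>
     Base = Set_star,
     Fib = (\<lambda>A. \<lparr>carrier = Pow A, eq = (=), le = (\<subseteq>)\<rparr>),
     Reidx = (\<lambda>(A, f, B) S. {a \<in> A. f a \<in> S})\<rparr>"

end

theory Submission
  imports Defs
begin

text \<open>
  This is Henkin's completeness proof, with contexts of constants in place of a syntax. Fix a set of
  sorted constants; every finite set \<open>T\<close> of them has a product of sorts \<open>ctx T\<close>, and the formulas
  with constants in \<open>T\<close> are the elements of the fibre over \<open>ctx T\<close>. The constants are stratified by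
  level so that every formula \<open>\<exists>x. \<alpha>(x)\<close> has its own witness \<open>c\<close>, of a level above those of the
  constants in \<open>\<alpha>\<close>. The Henkin axioms \<open>\<exists>x. \<alpha>(x) \<longrightarrow> \<alpha>(c)\<close> are jointly consistent: adding a
  witness of highest level is conservative, and initially \<open>\<top>\<close> is not \<open>\<bottom>\<close> over any context, as the
  fibres are non-trivial. By Zorn's lemma they lie in a maximal consistent theory \<open>\<Gamma>\<close>, which decides
  every formula and hence treats implication classically. The model sends a sort \<open>B\<close> to the filtered
  colimit of the sets \<open>Hom (ctx T) B\<close>, and \<open>\<beta>\<close> over \<open>B\<close> to the set of all \<open>t\<close> such that the
  reindexing of \<open>\<beta>\<close> along \<open>t\<close> is in \<open>\<Gamma>\<close>.
\<close>

section \<open>Cardinality\<close>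

text \<open>The obstacle is that weakening need not reflect the order: a sort may receive no arrow
  from the terminal object, and a constant of that sort is then a genuine assumption. So entailment
  is tested after enlarging the context, and consistency is demanded over every larger context; this
  is why the fibres over all objects, and not only the one over the terminal object, must be
  non-trivial. The same constants make every carrier of the model non-empty, as
  \<open>Set_star\<close> requires. Levels replace the usual tower of languages. A context is
  finite, so a witness one level above its largest constant is fresh for it, and all constants can
  be given at once. There is a circularity to break: the sorts determine the contexts, the contexts
  determine the existential formulas, and these determine the sorts of their witnesses. It is broken
  by coding tuples over arbitrary objects before any context exists and decoding the sort from the
  code. The doctrine has no disjunction, so a complete theory is described by implication into
  bottom, and the colimit of the fibres is handled as a preorder on pairs of a context and a
  formula.\<close>

lemma infinite_square_lepoll: "infinite A \<Longrightarrow> A \<times> A \<lesssim> A"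
  using card_of_Times_same_infinite[of A] eqpoll_iff_card_of_ordIso eqpoll_imp_lepoll by blast

lemma Sigma_lepoll_infinite:
  assumes "infinite U" "I \<lesssim> U" "\<And>i. i \<in> I \<Longrightarrow> A i \<lesssim> U"
  shows "Sigma I A \<lesssim> U"
proof -
  have "Sigma I A \<lesssim> Sigma I (\<lambda>_. U)"
    using assms(3) by (rule Sigma_lepoll_mono[OF order_refl])
  also have "\<dots> \<lesssim> U \<times> U" using assms(2) by (rule times_lepoll_mono) simp
  also have "\<dots> \<lesssim> U" using assms(1) by (rule infinite_square_lepoll)
  finally show ?thesis .
qed

text \<open>Finite sets are images of lists, and lists of a fixed length embed by induction on the
  length. Contexts are finite sets of constants, so this keeps their number within the
  universe.\<close>

lemma finite_subsets_lepoll_infinite: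
  assumes "infinite U" "K \<lesssim> U"
  shows "{T. T \<subseteq> K \<and> finite T} \<lesssim> U"
proof -
  define L where "L n = {xs. set xs \<subseteq> K \<and> length xs = n}" for n
  have L: "L n \<lesssim> U" for n
  proof (induction n)
    case 0
    have "finite (L 0)" by (simp add: L_def)
    with assms(1) show ?case by (rule finite_lepoll_infinite)
  next
    case (Suc n)
    have "L (Suc n) \<subseteq> (\<lambda>(x, xs). x # xs) ` (K \<times> L n)"
      by (auto simp: L_def length_Suc_conv image_iff)
    then have "L (Suc n) \<lesssim> K \<times> L n" by (rule subset_image_lepoll)
    also have "\<dots> \<lesssim> U" using assms Suc by (intro Sigma_lepoll_infinite)
    finally show ?case .
  qed
  have "{T. T \<subseteq> K \<and> finite T} \<subseteq> (\<lambda>(n, xs). set xs) ` Sigma UNIV L"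
    by (force simp: L_def image_iff dest: finite_list)
  then have "{T. T \<subseteq> K \<and> finite T} \<lesssim> Sigma UNIV L" by (rule subset_image_lepoll)
  also have "\<dots> \<lesssim> U"
    using assms(1) L by (intro Sigma_lepoll_infinite) (auto simp: infinite_le_lepoll)
  finally show ?thesis .
qed

section \<open>The doctrine of subsets\<close>

abbreviation set_fun :: "'u set_arrow \<Rightarrow> 'u \<Rightarrow> 'u" where
  "set_fun f \<equiv> fst (snd f)"

section \<open>The category of non-empty sets and its finite products\<close>

lemma Obj_Set_star [simp]: "A \<in> Obj Set_star \<longleftrightarrow> A \<noteq> {}"
  by (simp add: Set_star_def)

lemma Hom_Set_star:
  "f \<in> Hom Set_star A B \<longleftrightarrow> A \<noteq> {} \<and> B \<noteq> {} \<and> (\<exists>\<phi> \<in> A \<rightarrow>\<^sub>E B. f = (A, \<phi>, B))"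
  by (auto simp: Hom_def Set_star_def)

lemma Comp_Set_star [simp]:
  "Comp Set_star (B, g, D) (A, f, B') = (A, compose A g f, D)"
  by (simp add: Set_star_def)

lemma Ide_Set_star [simp]: "Ide Set_star A = (A, restrict id A, A)"
  by (simp add: Set_star_def)

lemma category_Set_star: "category Set_star"
proof
  fix f :: "'a set_arrow" assume "f \<in> Arr Set_star"
  then show "Dom Set_star f \<in> Obj Set_star" "Cod Set_star f \<in> Obj Set_star"
    by (auto simp: Set_star_def)
next
  fix A :: "'a set" assume "A \<in> Obj Set_star"
  then show "Ide Set_star A \<in> Hom Set_star A A"
    by (auto simp: Hom_Set_star)
next
  fix f g :: "'a set_arrow" and A B D
  assume "f \<in> Hom Set_star A B" "g \<in> Hom Set_star B D"
  then show "Comp Set_star g f \<in> Hom Set_star A D"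
    by (force simp: Hom_Set_star compose_def)
next
  fix f :: "'a set_arrow" and A B
  assume "f \<in> Hom Set_star A B"
  then obtain \<phi> where \<phi>: "\<phi> \<in> A \<rightarrow>\<^sub>E B" and f: "f = (A, \<phi>, B)"
    by (auto simp: Hom_Set_star)
  have "compose A \<phi> (restrict id A) = \<phi>" "compose A (restrict id B) \<phi> = \<phi>"
    using \<phi> by (auto simp: compose_def fun_eq_iff PiE_def extensional_def)
  then show "Comp Set_star f (Ide Set_star A) = f" "Comp Set_star (Ide Set_star B) f = f"
    by (simp_all add: f)
next
  fix f g h :: "'a set_arrow" and A B D E
  assume "f \<in> Hom Set_star A B" "g \<in> Hom Set_star B D" "h \<in> Hom Set_star D E"
  then obtain \<phi> \<psi> \<chi> where "f = (A, \<phi>, B)" "g = (B, \<psi>, D)" "h = (D, \<chi>, E)"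
    and \<phi>: "\<phi> \<in> A \<rightarrow> B"
    unfolding Hom_Set_star by blast
  then show "Comp Set_star h (Comp Set_star g f) = Comp Set_star (Comp Set_star h g) f"
    using compose_assoc[OF \<phi>, of \<chi> \<psi>] by simp
qed

lemmas Comp_Hom_Set_star = category.Comp_Hom[OF category_Set_star]

lemma set_arrow_eqI:
  assumes "f \<in> Hom Set_star A B" "g \<in> Hom Set_star A B" "\<And>a. a \<in> A \<Longrightarrow> set_fun f a = set_fun g a"
  shows "f = g"
proof -
  obtain \<phi> \<psi> where \<phi>: "\<phi> \<in> A \<rightarrow>\<^sub>E B" "f = (A, \<phi>, B)" and \<psi>: "\<psi> \<in> A \<rightarrow>\<^sub>E B" "g = (A, \<psi>, B)"
    using assms(1,2) by (auto simp: Hom_Set_star)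
  have "\<phi> = \<psi>" by (rule PiE_ext[OF \<phi>(1) \<psi>(1)]) (use assms(3) \<phi> \<psi> in auto)
  then show ?thesis using \<phi> \<psi> by simp
qed

lemma set_fun_mem: "f \<in> Hom Set_star A B \<Longrightarrow> a \<in> A \<Longrightarrow> set_fun f a \<in> B"
  by (auto simp: Hom_Set_star)

text \<open>A form for automation, which splits an arrow into its triple and simplifies
  \<open>set_fun\<close> away, so that \<open>set_fun_mem\<close> no longer matches.\<close>

lemma set_fun_mem_triple: "(A', f, B') \<in> Hom Set_star A B \<Longrightarrow> a \<in> A \<Longrightarrow> f a \<in> B"
  by (auto simp: Hom_Set_star)

lemma set_fun_Comp:
  "f \<in> Hom Set_star A B \<Longrightarrow> g \<in> Hom Set_star B D \<Longrightarrow> a \<in> A \<Longrightarrow>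
    set_fun (Comp Set_star g f) a = set_fun g (set_fun f a)"
  by (auto simp: Hom_Set_star compose_def)

lemma restrict_in_Hom_Set_star:
  "A \<noteq> {} \<Longrightarrow> (\<And>a. a \<in> A \<Longrightarrow> f a \<in> B) \<Longrightarrow> (A, restrict f A, B) \<in> Hom Set_star A B"
  by (force simp: Hom_Set_star)

lemma is_terminal_singleton: "is_terminal Set_star {u}"
proof -
  have "\<exists>!f. f \<in> Hom Set_star A {u}" if "A \<noteq> {}" for A :: "'a set"
  proof
    show "(A, \<lambda>x\<in>A. u, {u}) \<in> Hom Set_star A {u}"
      using that by (rule restrict_in_Hom_Set_star) simp
    fix f assume "f \<in> Hom Set_star A {u}"
    then show "f = (A, \<lambda>x\<in>A. u, {u})"
      by (auto simp: Hom_Set_star intro!: PiE_ext[of _ A "\<lambda>_. {u}"])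
  qed
  then show ?thesis by (simp add: is_terminal_def)
qed

text \<open>Elements are arrows from a one-point set, so testing the universal property there gives
  the pointwise condition; conversely the mediating arrow is found point by point. Since products
  are not chosen, this is the only access to the elements of an arbitrary cone.\<close>

lemma is_product_Set_star:
  fixes X A B :: "'u set"
  shows "is_product Set_star X A B p q \<longleftrightarrow> p \<in> Hom Set_star X A \<and> q \<in> Hom Set_star X B \<and>
    (\<forall>a\<in>A. \<forall>b\<in>B. \<exists>!x. x \<in> X \<and> set_fun p x = a \<and> set_fun q x = b)"
    (is "?L \<longleftrightarrow> ?R")
proof
  assume L: ?L
  then have p: "p \<in> Hom Set_star X A" and q: "q \<in> Hom Set_star X B"
    by (auto simp: is_product_def)
  have "\<exists>!x. x \<in> X \<and> set_fun p x = a \<and> set_fun q x = b" if ab: "a \<in> A" "b \<in> B" for a b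
  proof -
    \<comment> \<open>The set {a} serves as the one-point domain for both coordinates, also for the
      arrow with value \<open>b\<close>.\<close>
    define f where "f = ({a}, \<lambda>x\<in>{a}. a, A)"
    define g where "g = ({a}, \<lambda>x\<in>{a}. b, B)"
    have f: "f \<in> Hom Set_star {a} A" unfolding f_def
      by (rule restrict_in_Hom_Set_star) (use ab in auto)
    have g: "g \<in> Hom Set_star {a} B" unfolding g_def
      by (rule restrict_in_Hom_Set_star) (use ab in auto)
    have ex1: "\<exists>!h. h \<in> Hom Set_star {a} X \<and> Comp Set_star p h = f \<and> Comp Set_star q h = g"
      using L f g by (simp add: is_product_def)
    then obtain h where h: "h \<in> Hom Set_star {a} X" "Comp Set_star p h = f" "Comp Set_star q h = g"
      by auto
    show ?thesis
    proof
      show "set_fun h a \<in> X \<and> set_fun p (set_fun h a) = a \<and> set_fun q (set_fun h a) = b"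
        using set_fun_mem[OF h(1)] set_fun_Comp[OF h(1) p, of a] set_fun_Comp[OF h(1) q, of a] h
        by (auto simp: f_def g_def)
      fix x assume x: "x \<in> X \<and> set_fun p x = a \<and> set_fun q x = b"
      define k where "k = ({a}, \<lambda>_\<in>{a}. x, X)"
      have k: "k \<in> Hom Set_star {a} X" unfolding k_def
        by (rule restrict_in_Hom_Set_star) (use x in auto)
      have sk: "set_fun k a = x" by (simp add: k_def)
      have "Comp Set_star p k = f"
        by (rule set_arrow_eqI[OF Comp_Hom_Set_star[OF k p] f])
          (use x sk in \<open>auto simp: set_fun_Comp[OF k p] f_def\<close>)
      moreover have "Comp Set_star q k = g"
        by (rule set_arrow_eqI[OF Comp_Hom_Set_star[OF k q] g])
          (use x sk in \<open>auto simp: set_fun_Comp[OF k q] g_def\<close>)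
      ultimately have "k = h" using ex1 h k by blast
      then show "x = set_fun h a" using sk by simp
    qed
  qed
  with p q show ?R by blast
next
  assume R: ?R
  then have p: "p \<in> Hom Set_star X A" and q: "q \<in> Hom Set_star X B"
    and ex1: "\<And>a b. a \<in> A \<Longrightarrow> b \<in> B \<Longrightarrow> \<exists>!x. x \<in> X \<and> set_fun p x = a \<and> set_fun q x = b"
    by blast+
  have "\<exists>!h. h \<in> Hom Set_star Y X \<and> Comp Set_star p h = f \<and> Comp Set_star q h = g"
    if Y: "Y \<noteq> {}" and f: "f \<in> Hom Set_star Y A" and g: "g \<in> Hom Set_star Y B" for Y f g
  proof -
    define k where "k y = (THE x. x \<in> X \<and> set_fun p x = set_fun f y \<and> set_fun q x = set_fun g y)" for y
    have k: "k y \<in> X \<and> set_fun p (k y) = set_fun f y \<and> set_fun q (k y) = set_fun g y"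
      if "y \<in> Y" for y
      unfolding k_def by (rule theI'[OF ex1[OF set_fun_mem[OF f that] set_fun_mem[OF g that]]])
    define h where "h = (Y, restrict k Y, X)"
    have h: "h \<in> Hom Set_star Y X" unfolding h_def
      by (rule restrict_in_Hom_Set_star) (use Y k in auto)
    have sh: "set_fun h y = k y" if "y \<in> Y" for y using that by (simp add: h_def)
    show ?thesis
    proof
      have "Comp Set_star p h = f"
        by (rule set_arrow_eqI[OF Comp_Hom_Set_star[OF h p] f])
          (use k sh in \<open>auto simp: set_fun_Comp[OF h p]\<close>)
      moreover have "Comp Set_star q h = g"
        by (rule set_arrow_eqI[OF Comp_Hom_Set_star[OF h q] g])
          (use k sh in \<open>auto simp: set_fun_Comp[OF h q]\<close>)
      ultimately show "h \<in> Hom Set_star Y X \<and> Comp Set_star p h = f \<and> Comp Set_star q h = g"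
        using h by simp
      fix h' assume "h' \<in> Hom Set_star Y X \<and> Comp Set_star p h' = f \<and> Comp Set_star q h' = g"
      then have h': "h' \<in> Hom Set_star Y X" and eq: "Comp Set_star p h' = f" "Comp Set_star q h' = g"
        by auto
      show "h' = h"
      proof (rule set_arrow_eqI[OF h' h])
        fix y assume y: "y \<in> Y"
        have "set_fun p (set_fun h' y) = set_fun f y" "set_fun q (set_fun h' y) = set_fun g y"
          using set_fun_Comp[OF h' p y] set_fun_Comp[OF h' q y] eq by auto
        moreover have "set_fun h' y \<in> X" using h' y by (rule set_fun_mem)
        ultimately show "set_fun h' y = set_fun h y"
          using ex1[OF set_fun_mem[OF f y] set_fun_mem[OF g y]] k[OF y] unfolding sh[OF y] by blast
      qed
    qed
  qed
  then show ?L using p q by (auto simp: is_product_def)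
qed

text \<open>An injection \<open>b\<close> of the square of the universe into the universe codes
  pairs, so the image of the cartesian product under \<open>b\<close> is a product object.\<close>

lemma finite_product_category_Set_star:
  assumes "infinite (UNIV :: 'u set)"
  shows "finite_product_category (Set_star :: ('u set, 'u set_arrow) cat)"
proof -
  obtain b :: "'u \<times> 'u \<Rightarrow> 'u" where b: "inj b"
    using infinite_square_lepoll[OF assms] by (auto simp: lepoll_def)
  interpret category "Set_star :: ('u set, 'u set_arrow) cat" by (rule category_Set_star)
  show ?thesis
  proof
    show "\<exists>T. is_terminal (Set_star :: ('u set, 'u set_arrow) cat) T"
      by (rule exI) (rule is_terminal_singleton)
    fix A B :: "'u set" assume ne: "A \<in> Obj Set_star" "B \<in> Obj Set_star"
    define X where "X = b ` (A \<times> B)"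
    define p where "p = (X, \<lambda>x\<in>X. fst (inv b x), A)"
    define q where "q = (X, \<lambda>x\<in>X. snd (inv b x), B)"
    have X: "X \<noteq> {}" using ne by (auto simp: X_def)
    have [simp]: "inv b (b y) = y" for y using b by simp
    have "p \<in> Hom Set_star X A" unfolding p_def
      by (rule restrict_in_Hom_Set_star[OF X]) (auto simp: X_def)
    moreover have "q \<in> Hom Set_star X B" unfolding q_def
      by (rule restrict_in_Hom_Set_star[OF X]) (auto simp: X_def)
    moreover have "\<exists>!x. x \<in> X \<and> set_fun p x = a \<and> set_fun q x = c" if "a \<in> A" "c \<in> B" for a c
      by (rule ex1I[of _ "b (a, c)"]) (use that in \<open>auto simp: X_def p_def q_def\<close>)
    ultimately have "is_product Set_star X A B p q"
      unfolding is_product_Set_star by blast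
    then show "\<exists>X p q. is_product Set_star X A B p q" by blast
  qed
qed

section \<open>Order, implication and quantifiers on subsets\<close>

lemma Base_subsets [simp]: "Base subsets_doctrine = Set_star"
  by (simp add: subsets_doctrine_def)

lemma Reidx_subsets:
  "f \<in> Hom Set_star A B \<Longrightarrow> Reidx subsets_doctrine f S = {a \<in> A. set_fun f a \<in> S}"
  by (auto simp: subsets_doctrine_def Hom_Set_star)

lemma carrier_subsets [simp]: "carrier (Fib subsets_doctrine A) = Pow A"
  by (simp add: subsets_doctrine_def)

lemma le_subsets [simp]: "X \<sqsubseteq>\<^bsub>Fib subsets_doctrine A\<^esub> Y \<longleftrightarrow> X \<subseteq> Y"
  by (simp add: subsets_doctrine_def)

lemma partial_order_subsets: "partial_order (Fib subsets_doctrine A)"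
  by standard (auto simp: subsets_doctrine_def)

lemma lower_semilattice_subsets: "lower_semilattice (Fib subsets_doctrine A)"
proof -
  interpret partial_order "Fib subsets_doctrine A" by (rule partial_order_subsets)
  show ?thesis
  proof
    fix X Y assume "X \<in> carrier (Fib subsets_doctrine A)" "Y \<in> carrier (Fib subsets_doctrine A)"
    then have "greatest (Fib subsets_doctrine A) (X \<inter> Y) (Lower (Fib subsets_doctrine A) {X, Y})"
      by (auto simp: greatest_def Lower_def)
    then show "\<exists>s. greatest (Fib subsets_doctrine A) s (Lower (Fib subsets_doctrine A) {X, Y})" ..
  qed
qed

lemma meet_subsets [simp]:
  assumes "X \<subseteq> A" "Y \<subseteq> A"
  shows "X \<sqinter>\<^bsub>Fib subsets_doctrine A\<^esub> Y = X \<inter> Y"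
proof -
  interpret lower_semilattice "Fib subsets_doctrine A" by (rule lower_semilattice_subsets)
  show ?thesis
    using meet_left[of X Y] meet_right[of X Y] meet_le[of "X \<inter> Y" X Y] assms by auto
qed

lemma weak_partial_order_top_subsets: "weak_partial_order_top (Fib subsets_doctrine A)"
proof -
  interpret partial_order "Fib subsets_doctrine A" by (rule partial_order_subsets)
  show ?thesis by standard (auto simp: greatest_def)
qed

lemma weak_partial_order_bottom_subsets: "weak_partial_order_bottom (Fib subsets_doctrine A)"
proof -
  interpret partial_order "Fib subsets_doctrine A" by (rule partial_order_subsets)
  show ?thesis by standard (auto simp: least_def)
qed

lemma top_subsets [simp]: "\<top>\<^bsub>Fib subsets_doctrine A\<^esub> = A"
proof -
  interpret weak_partial_order_top "Fib subsets_doctrine A" by (rule weak_partial_order_top_subsets)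
  show ?thesis using top_closed top_higher[of A] by auto
qed

lemma bottom_subsets [simp]: "\<bottom>\<^bsub>Fib subsets_doctrine A\<^esub> = {}"
proof -
  interpret weak_partial_order_bottom "Fib subsets_doctrine A"
    by (rule weak_partial_order_bottom_subsets)
  show ?thesis using bottom_closed bottom_lower[of "{}"] by auto
qed

text \<open>An equivalence is needed because \<open>himp\<close> is a \<open>SOME\<close>: only
  uniqueness turns it into a computable value. One inclusion tests the adjunction at the explicit
  candidate, the other at \<open>I\<close> itself.\<close>

lemma is_himp_subsets:
  assumes "X \<subseteq> A" "Y \<subseteq> A"
  shows "is_himp (Fib subsets_doctrine A) X Y I \<longleftrightarrow> I = (A - X) \<union> Y"
proof
  assume I: "is_himp (Fib subsets_doctrine A) X Y I"
  then have IA: "I \<subseteq> A" and adj: "\<And>Z. Z \<subseteq> A \<Longrightarrow> Z \<subseteq> I \<longleftrightarrow> Z \<inter> X \<subseteq> Y"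
    using assms by (auto simp: is_himp_def)
  have "(A - X) \<union> Y \<subseteq> I" by (rule adj[THEN iffD2]) (use assms in auto)
  moreover have "I \<inter> X \<subseteq> Y" using adj[of I] IA by auto
  ultimately show "I = (A - X) \<union> Y" using IA by auto
qed (use assms in \<open>auto simp: is_himp_def\<close>)

lemma himp_subsets [simp]:
  "X \<subseteq> A \<Longrightarrow> Y \<subseteq> A \<Longrightarrow> himp (Fib subsets_doctrine A) X Y = (A - X) \<union> Y"
  by (simp add: himp_def is_himp_subsets)

text \<open>Again uniqueness is what evaluates the \<open>SOME\<close> in \<open>ex\<close>. The two
  inclusions come from testing the adjunction at the direct image and at \<open>E S\<close>.\<close>

lemma is_left_adjoint_subsets:
  assumes f: "f \<in> Hom Set_star A B"
  shows "is_left_adjoint subsets_doctrine f E \<longleftrightarrow> (\<forall>S\<subseteq>A. E S = set_fun f ` S)"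
proof -
  have DC: "Dom Set_star f = A" "Cod Set_star f = B" using f by (auto simp: Hom_def)
  have eq: "is_left_adjoint subsets_doctrine f E \<longleftrightarrow>
      (\<forall>S\<subseteq>A. E S \<subseteq> B) \<and> (\<forall>S\<subseteq>A. \<forall>T\<subseteq>B. E S \<subseteq> T \<longleftrightarrow> S \<subseteq> {a \<in> A. set_fun f a \<in> T})"
    using f by (auto simp: is_left_adjoint_def DC galois_connection_def connection_def
      galois_connection_axioms_def partial_order_subsets Reidx_subsets Pi_iff)
  show ?thesis
  proof
    assume "is_left_adjoint subsets_doctrine f E"
    then have sub: "\<And>S. S \<subseteq> A \<Longrightarrow> E S \<subseteq> B"
      and adj: "\<And>S T. S \<subseteq> A \<Longrightarrow> T \<subseteq> B \<Longrightarrow> E S \<subseteq> T \<longleftrightarrow> S \<subseteq> {a \<in> A. set_fun f a \<in> T}"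
      using eq by blast+
    show "\<forall>S\<subseteq>A. E S = set_fun f ` S"
    proof (intro allI impI equalityI)
      fix S assume S: "S \<subseteq> A"
      have im: "set_fun f ` S \<subseteq> B" using S set_fun_mem[OF f] by auto
      show "E S \<subseteq> set_fun f ` S" using adj[OF S im] S by auto
      show "set_fun f ` S \<subseteq> E S" using adj[OF S sub[OF S]] by auto
    qed
  next
    assume E: "\<forall>S\<subseteq>A. E S = set_fun f ` S"
    show "is_left_adjoint subsets_doctrine f E"
      unfolding eq using E set_fun_mem[OF f] by auto
  qed
qed

lemma ex_subsets:
  assumes "f \<in> Hom Set_star A B" "S \<subseteq> A"
  shows "ex subsets_doctrine f S = set_fun f ` S"
proof -
  have "is_left_adjoint subsets_doctrine f (ex subsets_doctrine f)"
    unfolding ex_def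
    by (rule someI[of _ "\<lambda>S. set_fun f ` S"]) (simp add: is_left_adjoint_subsets[OF assms(1)])
  then show ?thesis using assms by (simp add: is_left_adjoint_subsets)
qed

context
  assumes universe: "infinite (UNIV :: 'u set)"
begin

lemma doctrine_subsets: "doctrine (subsets_doctrine :: ('u set, _, _) doctrine)"
proof (rule doctrine.intro)
  show "finite_product_category (Base (subsets_doctrine :: ('u set, _, _) doctrine))"
    using universe by (simp add: finite_product_category_Set_star)
  fix A B D :: "'u set" and f g S
  show "partial_order (Fib subsets_doctrine A)" by (rule partial_order_subsets)
  show "Reidx subsets_doctrine (Ide (Base subsets_doctrine) A) S = S"
    if "A \<in> Obj (Base subsets_doctrine)" "S \<in> carrier (Fib subsets_doctrine A)"
    using that category.Ide_Hom[OF category_Set_star, of A]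
    \<comment> \<open>The first call uses that the identity belongs to its hom-set and must not
      expand it; the second evaluates it.\<close>
    by (auto simp: Reidx_subsets[of _ A A] simp del: Ide_Set_star) (auto simp: Reidx_subsets)
  assume f: "f \<in> Hom (Base subsets_doctrine) A B"
  then show "Reidx subsets_doctrine f \<in> carrier (Fib subsets_doctrine B) \<rightarrow> carrier (Fib subsets_doctrine A)"
    by (auto simp: Reidx_subsets)
  show "isotone (Fib subsets_doctrine B) (Fib subsets_doctrine A) (Reidx subsets_doctrine f)"
    by (rule isotoneI) (use f partial_order_subsets partial_order.axioms in \<open>auto simp: Reidx_subsets\<close>)
  assume g: "g \<in> Hom (Base subsets_doctrine) B D"
  show "Reidx subsets_doctrine (Comp (Base subsets_doctrine) g f) S
      = Reidx subsets_doctrine f (Reidx subsets_doctrine g S)"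
    using f g Comp_Hom_Set_star[of f A B g D]
    by (auto simp: Reidx_subsets set_fun_Comp set_fun_mem)
qed

lemma bounded_subsets: "bounded_doctrine (subsets_doctrine :: ('u set, _, _) doctrine)"
  by (intro bounded_doctrine.intro bounded_doctrine_axioms.intro doctrine_subsets)
    (auto simp: weak_partial_order_top_subsets weak_partial_order_bottom_subsets
      Reidx_subsets dest: set_fun_mem_triple)

lemma primary_subsets: "primary_doctrine (subsets_doctrine :: ('u set, _, _) doctrine)"
  by (intro primary_doctrine.intro primary_doctrine_axioms.intro doctrine_subsets)
    (auto simp: weak_partial_order_top_subsets lower_semilattice_subsets
      Reidx_subsets meet_subsets[OF Collect_subset Collect_subset] dest: set_fun_mem_triple)

lemma implicational_subsets: "implicational_doctrine (subsets_doctrine :: ('u set, _, _) doctrine)"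
proof -
  interpret primary_doctrine "subsets_doctrine :: ('u set, _, _) doctrine" by (rule primary_subsets)
  show ?thesis
    by standard (auto simp: is_himp_subsets Reidx_subsets dest: set_fun_mem_triple)
qed

lemma existential_subsets: "existential_doctrine (subsets_doctrine :: ('u set, _, _) doctrine)"
proof -
  interpret primary_doctrine "subsets_doctrine :: ('u set, _, _) doctrine" by (rule primary_subsets)
  show ?thesis
  proof
    fix X C B :: "'u set" and p q
    assume "is_product (Base subsets_doctrine) X C B p q"
    then have p: "p \<in> Hom Set_star X C" by (simp add: is_product_def)
    show "\<exists>E. is_left_adjoint subsets_doctrine p E"
      unfolding is_left_adjoint_subsets[OF p] by (rule exI[of _ "image (set_fun p)"]) simp
    fix S T assume "S \<in> carrier (Fib subsets_doctrine X)" "T \<in> carrier (Fib subsets_doctrine C)"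
    then have ST: "S \<subseteq> X" "T \<subseteq> C" by auto
    have "set_fun p ` S \<subseteq> C" using set_fun_mem[OF p] ST by blast
    moreover have "{a \<in> X. set_fun p a \<in> T} \<subseteq> X" "S \<inter> {a \<in> X. set_fun p a \<in> T} \<subseteq> X" by blast+
    moreover have "set_fun p ` (S \<inter> {a \<in> X. set_fun p a \<in> T}) = set_fun p ` S \<inter> T"
      using ST by blast
    ultimately show "ex subsets_doctrine p (S \<sqinter>\<^bsub>Fib subsets_doctrine X\<^esub> Reidx subsets_doctrine p T) =
        ex subsets_doctrine p S \<sqinter>\<^bsub>Fib subsets_doctrine C\<^esub> T"
      using ST by (simp only: ex_subsets[OF p] Reidx_subsets[OF p] meet_subsets)
  next
    fix X C B X' C' :: "'u set" and p q p' q' f h S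
    assume prod: "is_product (Base subsets_doctrine) X C B p q"
      and prod': "is_product (Base subsets_doctrine) X' C' B p' q'"
      and f: "f \<in> Hom (Base subsets_doctrine) C C'" and h: "h \<in> Hom (Base subsets_doctrine) X X'"
      and sq: "Comp (Base subsets_doctrine) p' h = Comp (Base subsets_doctrine) f p"
        "Comp (Base subsets_doctrine) q' h = q"
      and S: "S \<in> carrier (Fib subsets_doctrine X')"
    have p: "p \<in> Hom Set_star X C" "q \<in> Hom Set_star X B"
      and p': "p' \<in> Hom Set_star X' C'" "q' \<in> Hom Set_star X' B"
      using prod prod' by (auto simp: is_product_def)
    have h': "h \<in> Hom Set_star X X'" and f': "f \<in> Hom Set_star C C'" using f h by auto
    have comm: "set_fun p' (set_fun h x) = set_fun f (set_fun p x)"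
      "set_fun q' (set_fun h x) = set_fun q x" if "x \<in> X" for x
      using sq set_fun_Comp[OF h' p'(1) that] set_fun_Comp[OF h' p'(2) that]
        set_fun_Comp[OF p(1) f' that] by auto
    \<comment> \<open>The substantial inclusion of Beck-Chevalley: the element of \<open>X\<close>
      with first coordinate \<open>c\<close> and the second coordinate of \<open>s\<close> is sent
      by \<open>h\<close> to \<open>s\<close>, because an element of \<open>X'\<close> is determined
      by its coordinates.\<close>
    have "c \<in> set_fun p ` {x \<in> X. set_fun h x \<in> S}" if c: "c \<in> C" "set_fun f c \<in> set_fun p' ` S" for c
    proof -
      obtain s where s: "s \<in> S" "set_fun f c = set_fun p' s" using c by auto
      have "s \<in> X'" using s S by auto
      then have "set_fun q' s \<in> B" by (rule set_fun_mem[OF p'(2)])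
      with prod c(1) obtain x where x: "x \<in> X" "set_fun p x = c" "set_fun q x = set_fun q' s"
        unfolding is_product_Set_star Base_subsets by blast
      have hx: "set_fun h x \<in> X'" using h' x(1) by (rule set_fun_mem)
      have eq: "set_fun p' (set_fun h x) = set_fun p' s" "set_fun q' (set_fun h x) = set_fun q' s"
        using comm x s by auto
      have "\<exists>!y. y \<in> X' \<and> set_fun p' y = set_fun p' s \<and> set_fun q' y = set_fun q' s"
        using prod' set_fun_mem[OF p'(1) \<open>s \<in> X'\<close>] set_fun_mem[OF p'(2) \<open>s \<in> X'\<close>]
        unfolding is_product_Set_star Base_subsets by blast
      then have "set_fun h x = s" using hx eq \<open>s \<in> X'\<close> by blast
      then show ?thesis using x s by auto
    qed
    moreover have "set_fun p x \<in> C" "set_fun f (set_fun p x) \<in> set_fun p' ` S"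
      if "x \<in> X" "set_fun h x \<in> S" for x
      using that comm(1)[of x] set_fun_mem[OF p(1)] by (auto simp: rev_image_eqI)
    ultimately have "set_fun p ` {x \<in> X. set_fun h x \<in> S} = {c \<in> C. set_fun f c \<in> set_fun p' ` S}"
      by blast
    moreover have "S \<subseteq> X'" using S by simp
    ultimately show "ex subsets_doctrine p (Reidx subsets_doctrine h S) =
        Reidx subsets_doctrine f (ex subsets_doctrine p' S)"
      by (simp add: ex_subsets[OF p(1)] ex_subsets[OF p'(1)] Reidx_subsets[OF h'] Reidx_subsets[OF f'])
  qed
qed

end

section \<open>Maximal sets with the finite intersection property\<close>

text \<open>Think of \<open>lq\<close> as a preorder on \<open>Q\<close> and of \<open>pos\<close> as being different from its bottom.\<close>

definition compatible :: "'q set \<Rightarrow> ('q \<Rightarrow> 'q \<Rightarrow> bool) \<Rightarrow> ('q \<Rightarrow> bool) \<Rightarrow> 'q set \<Rightarrow> bool" where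
  "compatible Q lq pos \<Gamma> \<longleftrightarrow> \<Gamma> \<subseteq> Q \<and>
    (\<forall>\<Delta>. \<Delta> \<subseteq> \<Gamma> \<longrightarrow> finite \<Delta> \<longrightarrow> (\<exists>z\<in>Q. pos z \<and> (\<forall>y\<in>\<Delta>. lq z y)))"

lemma compatibleD:
  "compatible Q lq pos \<Gamma> \<Longrightarrow> \<Delta> \<subseteq> \<Gamma> \<Longrightarrow> finite \<Delta> \<Longrightarrow> \<exists>z\<in>Q. pos z \<and> (\<forall>y\<in>\<Delta>. lq z y)"
  by (simp add: compatible_def)

lemma compatible_Union:
  assumes "subset.chain {\<Gamma>. compatible Q lq pos \<Gamma>} \<C>" "\<C> \<noteq> {}"
  shows "compatible Q lq pos (\<Union>\<C>)"
  unfolding compatible_def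
proof (intro conjI allI impI)
  show "\<Union>\<C> \<subseteq> Q" using assms by (auto simp: subset_chain_def compatible_def)
  fix \<Delta> assume "\<Delta> \<subseteq> \<Union>\<C>" "finite \<Delta>"
  then obtain \<Gamma> where "\<Gamma> \<in> \<C>" "\<Delta> \<subseteq> \<Gamma>"
    using finite_subset_Union_chain[OF _ _ assms(2,1)] by metis
  with \<open>finite \<Delta>\<close> show "\<exists>z\<in>Q. pos z \<and> (\<forall>y\<in>\<Delta>. lq z y)"
    using assms(1) by (intro compatibleD[of Q lq pos \<Gamma>]) (auto simp: subset_chain_def)
qed

text \<open>The last property is maximality: enlarging by \<open>x\<close> fails at a finite set,
  from which \<open>x\<close> may be removed. It yields the closure property, since a common lower
  bound of that set and of \<Delta> would be below \<open>x\<close> after all. As \<open>Q\<close>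
  carries no meets, lower bounds of finite sets take their place.\<close>

lemma maximal_compatible_exists:
  assumes H: "compatible Q lq pos H"
  obtains \<Gamma> where "H \<subseteq> \<Gamma>" "compatible Q lq pos \<Gamma>"
    "\<And>x \<Delta>. x \<in> Q \<Longrightarrow> \<Delta> \<subseteq> \<Gamma> \<Longrightarrow> finite \<Delta> \<Longrightarrow>
      (\<And>z. z \<in> Q \<Longrightarrow> pos z \<Longrightarrow> \<forall>y\<in>\<Delta>. lq z y \<Longrightarrow> lq z x) \<Longrightarrow> x \<in> \<Gamma>"
    "\<And>x. x \<in> Q \<Longrightarrow> x \<notin> \<Gamma> \<Longrightarrow>
      \<exists>\<Delta>. \<Delta> \<subseteq> \<Gamma> \<and> finite \<Delta> \<and> (\<forall>z\<in>Q. pos z \<longrightarrow> (\<forall>y\<in>\<Delta>. lq z y) \<longrightarrow> \<not> lq z x)"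
proof -
  let ?\<A> = "{\<Gamma>. compatible Q lq pos \<Gamma> \<and> H \<subseteq> \<Gamma>}"
  have "\<exists>M\<in>?\<A>. \<forall>X\<in>?\<A>. M \<subseteq> X \<longrightarrow> X = M"
  proof (rule subset_Zorn_nonempty)
    show "?\<A> \<noteq> {}" using H by auto
    fix \<C> assume "\<C> \<noteq> {}" "subset.chain ?\<A> \<C>"
    then show "\<Union>\<C> \<in> ?\<A>"
      using compatible_Union[of Q lq pos \<C>] by (auto simp: subset_chain_def)
  qed
  then obtain \<Gamma> where \<Gamma>: "compatible Q lq pos \<Gamma>" "H \<subseteq> \<Gamma>"
    and max: "\<And>X. compatible Q lq pos X \<Longrightarrow> \<Gamma> \<subseteq> X \<Longrightarrow> X = \<Gamma>"
    by auto
  have incompatible: "\<exists>\<Delta>. \<Delta> \<subseteq> \<Gamma> \<and> finite \<Delta> \<and> (\<forall>z\<in>Q. pos z \<longrightarrow> (\<forall>y\<in>\<Delta>. lq z y) \<longrightarrow> \<not> lq z x)"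
    if x: "x \<in> Q" "x \<notin> \<Gamma>" for x
  proof -
    have "\<not> compatible Q lq pos (insert x \<Gamma>)" using max[of "insert x \<Gamma>"] x by auto
    moreover have "insert x \<Gamma> \<subseteq> Q" using \<Gamma> x by (auto simp: compatible_def)
    ultimately obtain \<Delta> where \<Delta>: "\<Delta> \<subseteq> insert x \<Gamma>" "finite \<Delta>"
      "\<not> (\<exists>z\<in>Q. pos z \<and> (\<forall>y\<in>\<Delta>. lq z y))"
      unfolding compatible_def by blast
    show ?thesis by (rule exI[of _ "\<Delta> - {x}"]) (use \<Delta> in auto)
  qed
  show ?thesis
  proof (rule that[OF \<Gamma>(2,1) _ incompatible])
    fix x \<Delta> assume x: "x \<in> Q" and \<Delta>: "\<Delta> \<subseteq> \<Gamma>" "finite \<Delta>"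
      and lq: "\<And>z. z \<in> Q \<Longrightarrow> pos z \<Longrightarrow> \<forall>y\<in>\<Delta>. lq z y \<Longrightarrow> lq z x"
    show "x \<in> \<Gamma>"
    proof (rule ccontr)
      assume "x \<notin> \<Gamma>"
      with incompatible x obtain \<Delta>' where \<Delta>': "\<Delta>' \<subseteq> \<Gamma>" "finite \<Delta>'"
        "\<forall>z\<in>Q. pos z \<longrightarrow> (\<forall>y\<in>\<Delta>'. lq z y) \<longrightarrow> \<not> lq z x" by blast
      obtain z where "z \<in> Q" "pos z" "\<forall>y\<in>\<Delta> \<union> \<Delta>'. lq z y"
        using compatibleD[OF \<Gamma>(1), of "\<Delta> \<union> \<Delta>'"] \<Delta> \<Delta>' by auto
      then show False using lq[of z] \<Delta>' by blast
    qed
  qed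
qed

section \<open>Finite products of a family of objects\<close>

text \<open>The index is a set and not a list, so that contexts are ordered by inclusion and any two
  finite ones have their union as a common enlargement.\<close>

definition is_family_product ::
    "('o, 'a) cat \<Rightarrow> 'o \<Rightarrow> 'k set \<Rightarrow> ('k \<Rightarrow> 'o) \<Rightarrow> ('k \<Rightarrow> 'a) \<Rightarrow> bool" where
  "is_family_product C X T \<sigma> \<pi> \<longleftrightarrow> X \<in> Obj C \<and> (\<forall>c\<in>T. \<pi> c \<in> Hom C X (\<sigma> c)) \<and>
    (\<forall>Y\<in>Obj C. \<forall>f. (\<forall>c\<in>T. f c \<in> Hom C Y (\<sigma> c)) \<longrightarrow>
      (\<exists>!h. h \<in> Hom C Y X \<and> (\<forall>c\<in>T. Comp C (\<pi> c) h = f c)))"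

lemma family_product_ex1:
  assumes "is_family_product C X T \<sigma> \<pi>" "Y \<in> Obj C" "\<And>c. c \<in> T \<Longrightarrow> f c \<in> Hom C Y (\<sigma> c)"
  shows "\<exists>!h. h \<in> Hom C Y X \<and> (\<forall>c\<in>T. Comp C (\<pi> c) h = f c)"
  using assms(1)[unfolded is_family_product_def, THEN conjunct2, THEN conjunct2, rule_format,
    OF assms(2), of f] assms(3) by blast

context category
begin

lemma Hom_Obj: "f \<in> Hom C A B \<Longrightarrow> A \<in> Obj C" "f \<in> Hom C A B \<Longrightarrow> B \<in> Obj C"
  using Dom_Obj Cod_Obj by (auto simp: Hom_def)

lemma product_Obj:
  assumes "is_product C X A B p q"
  shows "X \<in> Obj C" "A \<in> Obj C" "B \<in> Obj C"
  using assms Hom_Obj by (auto simp: is_product_def)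

lemma product_ex1:
  assumes "is_product C X A B p q" "f \<in> Hom C Y A" "g \<in> Hom C Y B"
  shows "\<exists>!h. h \<in> Hom C Y X \<and> Comp C p h = f \<and> Comp C q h = g"
  using assms Hom_Obj(1) unfolding is_product_def by blast

lemma product_eqI:
  assumes "is_product C X A B p q" "h \<in> Hom C Y X" "k \<in> Hom C Y X"
    "Comp C p h = Comp C p k" "Comp C q h = Comp C q k"
  shows "h = k"
proof -
  have "Comp C p h \<in> Hom C Y A" "Comp C q h \<in> Hom C Y B"
    using assms Comp_Hom unfolding is_product_def by blast+
  from product_ex1[OF assms(1) this] assms show ?thesis by metis
qed

lemma product_pair:
  assumes "is_product C X A B p q" "f \<in> Hom C Y A" "g \<in> Hom C Y B"
  obtains h where "h \<in> Hom C Y X" "Comp C p h = f" "Comp C q h = g"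
  using product_ex1[OF assms] by blast

lemma family_product_insert:
  assumes X: "is_family_product C X T \<sigma> \<pi>" and c: "c \<notin> T"
    and X': "is_product C X' X (\<sigma> c) p q"
  shows "is_family_product C X' (insert c T) \<sigma> (\<lambda>d. if d = c then q else Comp C (\<pi> d) p)"
    (is "is_family_product C X' _ \<sigma> ?\<pi>")
  unfolding is_family_product_def
proof (intro conjI ballI allI impI)
  show "X' \<in> Obj C" using product_Obj[OF X'] by simp
  have p: "p \<in> Hom C X' X" and q: "q \<in> Hom C X' (\<sigma> c)" using X' by (auto simp: is_product_def)
  have \<pi>: "\<pi> d \<in> Hom C X (\<sigma> d)" if "d \<in> T" for d
    using X that by (simp add: is_family_product_def)
  show "?\<pi> d \<in> Hom C X' (\<sigma> d)" if "d \<in> insert c T" for d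
    using that q Comp_Hom[OF p \<pi>] by auto
  fix Y f assume Y: "Y \<in> Obj C" and f: "\<forall>d\<in>insert c T. f d \<in> Hom C Y (\<sigma> d)"
  then have uniq: "\<exists>!h. h \<in> Hom C Y X \<and> (\<forall>d\<in>T. Comp C (\<pi> d) h = f d)"
    by (intro family_product_ex1[OF X]) blast+
  then obtain g where g: "g \<in> Hom C Y X" "\<And>d. d \<in> T \<Longrightarrow> Comp C (\<pi> d) g = f d" by blast
  have "f c \<in> Hom C Y (\<sigma> c)" using f by simp
  with X' g(1) obtain h where h: "h \<in> Hom C Y X'" "Comp C p h = g" "Comp C q h = f c"
    by (rule product_pair)
  show "\<exists>!h. h \<in> Hom C Y X' \<and> (\<forall>d\<in>insert c T. Comp C (?\<pi> d) h = f d)"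
  proof
    show "h \<in> Hom C Y X' \<and> (\<forall>d\<in>insert c T. Comp C (?\<pi> d) h = f d)"
      using h g Comp_assoc[OF h(1) p \<pi>] by auto
    fix k assume k: "k \<in> Hom C Y X' \<and> (\<forall>d\<in>insert c T. Comp C (?\<pi> d) k = f d)"
    then have kd: "Comp C (?\<pi> d) k = f d" if "d \<in> insert c T" for d
      using that by auto
    have "Comp C (\<pi> d) (Comp C p k) = f d" if "d \<in> T" for d
      using kd[of d] Comp_assoc[OF _ p \<pi>[OF that], of k Y] k c that by (cases "d = c") auto
    then have "Comp C p k = g" using uniq g Comp_Hom[OF _ p] k by blast
    moreover have "Comp C q k = f c" using kd[of c] by simp
    ultimately show "k = h"
      by (intro product_eqI[OF X' conjunct1[OF k] h(1)]) (simp_all only: h)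
  qed
qed

text \<open>The products for \<open>T\<close> and for \<open>insert c T\<close> are chosen
  independently, so the larger one is not built from the smaller; comparing universal properties
  shows that it is still a binary product with it. Hence dropping one constant is a first
  projection, along which the doctrine can quantify.\<close>

lemma is_product_insertI:
  assumes X: "is_family_product C X T \<sigma> \<pi>" and c: "c \<notin> T"
    and X': "is_family_product C X' (insert c T) \<sigma> \<pi>'"
    and \<rho>: "\<rho> \<in> Hom C X' X" "\<And>d. d \<in> T \<Longrightarrow> Comp C (\<pi> d) \<rho> = \<pi>' d"
  shows "is_product C X' X (\<sigma> c) \<rho> (\<pi>' c)"
  unfolding is_product_def
proof (intro conjI ballI)
  show "\<rho> \<in> Hom C X' X" by fact
  show "\<pi>' c \<in> Hom C X' (\<sigma> c)" using X' by (simp add: is_family_product_def)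
  have \<pi>: "\<pi> d \<in> Hom C X (\<sigma> d)" if "d \<in> T" for d
    using X that by (simp add: is_family_product_def)
  fix Y f g assume Y: "Y \<in> Obj C" and f: "f \<in> Hom C Y X" and g: "g \<in> Hom C Y (\<sigma> c)"
  let ?k = "\<lambda>d. if d = c then g else Comp C (\<pi> d) f"
  have uniq: "\<exists>!h. h \<in> Hom C Y X' \<and> (\<forall>d\<in>insert c T. Comp C (\<pi>' d) h = ?k d)"
    by (rule family_product_ex1[OF X' Y]) (use g Comp_Hom[OF f \<pi>] in auto)
  \<comment> \<open>Arrows into \<open>X\<close> agree exactly when their components do, so the
    binary conditions on \<open>h\<close> amount to the family conditions.\<close>
  have iff: "(Comp C \<rho> h = f \<and> Comp C (\<pi>' c) h = g) \<longleftrightarrow> (\<forall>d\<in>insert c T. Comp C (\<pi>' d) h = ?k d)"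
    if h: "h \<in> Hom C Y X'" for h
  proof -
    have eq: "Comp C (\<pi> d) (Comp C \<rho> h) = Comp C (\<pi>' d) h" if "d \<in> T" for d
      using Comp_assoc[OF h \<rho>(1) \<pi>[OF that]] \<rho>(2)[OF that] by simp
    have "\<exists>!h. h \<in> Hom C Y X \<and> (\<forall>d\<in>T. Comp C (\<pi> d) h = Comp C (\<pi> d) f)"
      by (rule family_product_ex1[OF X Y Comp_Hom[OF f \<pi>]])
    then have "Comp C \<rho> h = f \<longleftrightarrow> (\<forall>d\<in>T. Comp C (\<pi> d) (Comp C \<rho> h) = Comp C (\<pi> d) f)"
      using Comp_Hom[OF h \<rho>(1)] f by blast
    then show ?thesis using eq c by auto
  qed
  show "\<exists>!h. h \<in> Hom C Y X' \<and> Comp C \<rho> h = f \<and> Comp C (\<pi>' c) h = g"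
    using uniq iff by (simp cong: conj_cong)
qed

end

lemma (in finite_product_category) family_product_exists:
  assumes "finite T" "\<And>c. c \<in> T \<Longrightarrow> \<sigma> c \<in> Obj C"
  shows "\<exists>X \<pi>. is_family_product C X T \<sigma> \<pi>"
  using assms
proof (induction T)
  case empty
  then show ?case
    using terminal_exists by (auto simp: is_terminal_def is_family_product_def)
next
  case (insert c T)
  then obtain X \<pi> where X: "is_family_product C X T \<sigma> \<pi>" by auto
  then have "X \<in> Obj C" by (simp add: is_family_product_def)
  then obtain X' p q where "is_product C X' X (\<sigma> c) p q"
    using product_exists insert.prems by blast
  with family_product_insert[OF X \<open>c \<notin> T\<close>] show ?case by blast
qed

text \<open>The objects \<open>ctx T\<close>, for finite sets \<open>T\<close> of constants, are contexts of a many-sorted language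
  in which the constant \<open>c\<close> has sort \<open>\<sigma> c\<close>; \<open>wk S T\<close> is the weakening from \<open>T\<close> to \<open>S\<close>.\<close>

locale contexts = finite_product_category C for C :: "('o, 'a) cat" +
  fixes \<sigma> :: "'k \<Rightarrow> 'o"
  assumes sort_Obj: "\<sigma> c \<in> Obj C"
begin

definition ctx_cone :: "'k set \<Rightarrow> 'o \<times> ('k \<Rightarrow> 'a)" where
  "ctx_cone T = (SOME x. is_family_product C (fst x) T \<sigma> (snd x))"

definition ctx :: "'k set \<Rightarrow> 'o" where "ctx T = fst (ctx_cone T)"

definition var :: "'k set \<Rightarrow> 'k \<Rightarrow> 'a" where "var T = snd (ctx_cone T)"

lemma ctx_product: "finite T \<Longrightarrow> is_family_product C (ctx T) T \<sigma> (var T)"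
  using someI_ex[of "\<lambda>x. is_family_product C (fst x) T \<sigma> (snd x)"]
    family_product_exists[of T \<sigma>] sort_Obj
  by (auto simp: ctx_def var_def ctx_cone_def)

lemma ctx_Obj: "finite T \<Longrightarrow> ctx T \<in> Obj C"
  using ctx_product by (simp add: is_family_product_def)

lemma var_Hom: "finite T \<Longrightarrow> c \<in> T \<Longrightarrow> var T c \<in> Hom C (ctx T) (\<sigma> c)"
  using ctx_product by (simp add: is_family_product_def)

lemma ctx_ex1:
  assumes "finite T" "Y \<in> Obj C" "\<And>c. c \<in> T \<Longrightarrow> f c \<in> Hom C Y (\<sigma> c)"
  shows "\<exists>!h. h \<in> Hom C Y (ctx T) \<and> (\<forall>c\<in>T. Comp C (var T c) h = f c)"
  using ctx_product[OF assms(1)] assms(2,3) by (rule family_product_ex1)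

lemma ctx_eqI:
  assumes T: "finite T" and hk: "h \<in> Hom C Y (ctx T)" "k \<in> Hom C Y (ctx T)"
    and eq: "\<And>c. c \<in> T \<Longrightarrow> Comp C (var T c) h = Comp C (var T c) k"
  shows "h = k"
proof -
  have "\<exists>!h. h \<in> Hom C Y (ctx T) \<and> (\<forall>c\<in>T. Comp C (var T c) h = Comp C (var T c) k)"
    by (rule ctx_ex1[OF T Hom_Obj(1)[OF hk(1)]]) (rule Comp_Hom[OF hk(2) var_Hom[OF T]])
  then show ?thesis using hk eq by blast
qed

definition wk :: "'k set \<Rightarrow> 'k set \<Rightarrow> 'a" where
  "wk S T = (THE h. h \<in> Hom C (ctx S) (ctx T) \<and> (\<forall>c\<in>T. Comp C (var T c) h = var S c))"

lemma
  assumes "finite S" "T \<subseteq> S"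
  shows wk_Hom: "wk S T \<in> Hom C (ctx S) (ctx T)"
    and var_wk: "c \<in> T \<Longrightarrow> Comp C (var T c) (wk S T) = var S c"
proof -
  have "\<exists>!h. h \<in> Hom C (ctx S) (ctx T) \<and> (\<forall>c\<in>T. Comp C (var T c) h = var S c)"
    using assms by (intro ctx_ex1 ctx_Obj var_Hom) (auto intro: finite_subset)
  from theI'[OF this] show "wk S T \<in> Hom C (ctx S) (ctx T)"
    "c \<in> T \<Longrightarrow> Comp C (var T c) (wk S T) = var S c"
    by (auto simp: wk_def)
qed

lemma wk_refl: "finite T \<Longrightarrow> wk T T = Ide C (ctx T)"
  by (rule ctx_eqI[of T _ "ctx T"])
    (auto simp: wk_Hom var_wk Ide_Hom ctx_Obj Comp_Ide_right[OF var_Hom])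

lemma Comp_wk_wk:
  assumes "finite S" "T \<subseteq> S" "U \<subseteq> T"
  shows "Comp C (wk T U) (wk S T) = wk S U"
proof -
  have fin: "finite T" "finite U" and US: "U \<subseteq> S"
    using assms finite_subset[of T S] finite_subset[of U T] by auto
  note S = wk_Hom[OF assms(1,2)] and T = wk_Hom[OF fin(1) assms(3)] and U = wk_Hom[OF assms(1) US]
  show ?thesis
  proof (rule ctx_eqI[OF fin(2) Comp_Hom[OF S T] U])
    fix c assume c: "c \<in> U"
    show "Comp C (var U c) (Comp C (wk T U) (wk S T)) = Comp C (var U c) (wk S U)"
      using Comp_assoc[OF S T var_Hom[OF fin(2) c]] c var_wk[OF fin(1) assms(3) c]
        var_wk[OF assms(1,2), of c] var_wk[OF assms(1) US c] assms(3) by auto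
  qed
qed

lemma is_product_ctx_insert:
  assumes "finite T" "c \<notin> T"
  shows "is_product C (ctx (insert c T)) (ctx T) (\<sigma> c) (wk (insert c T) T) (var (insert c T) c)"
  using assms
  by (intro is_product_insertI[OF ctx_product _ ctx_product]) (auto intro!: wk_Hom var_wk)

end

section \<open>Heyting doctrines and complete theories\<close>

text \<open>The qualifier \<open>bounded\<close> keeps apart the facts on top elements, which occur
  under the same names in the primary and in the bounded structure.\<close>

locale heyting_doctrine =
  existential_doctrine P + implicational_doctrine P + bounded: bounded_doctrine P
  for P :: "('o, 'a, 'p) doctrine"
begin

sublocale base: finite_product_category "Base P" by (rule base)

abbreviation Hm where "Hm \<equiv> Hom (Base P)"

abbreviation cmp (infixl "\<cdot>" 70) where "g \<cdot> f \<equiv> Comp (Base P) g f"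

abbreviation fib :: "'o \<Rightarrow> 'p set" where
  "fib A \<equiv> carrier (Fib P A)"

abbreviation fib_le :: "'p \<Rightarrow> 'o \<Rightarrow> 'p \<Rightarrow> bool" ("(_/ \<preceq>\<^bsub>_\<^esub> _)" [51, 0, 51] 50) where
  "x \<preceq>\<^bsub>A\<^esub> y \<equiv> x \<sqsubseteq>\<^bsub>Fib P A\<^esub> y"

abbreviation fib_meet :: "'p \<Rightarrow> 'o \<Rightarrow> 'p \<Rightarrow> 'p" ("(_/ \<and>\<^bsub>_\<^esub> _)" [71, 0, 71] 70) where
  "x \<and>\<^bsub>A\<^esub> y \<equiv> x \<sqinter>\<^bsub>Fib P A\<^esub> y"

abbreviation fib_imp :: "'p \<Rightarrow> 'o \<Rightarrow> 'p \<Rightarrow> 'p" ("(_/ \<rightarrow>\<^bsub>_\<^esub> _)" [67, 0, 66] 66) where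
  "x \<rightarrow>\<^bsub>A\<^esub> y \<equiv> himp (Fib P A) x y"

abbreviation fib_bot :: "'o \<Rightarrow> 'p" where
  "fib_bot A \<equiv> \<bottom>\<^bsub>Fib P A\<^esub>"

abbreviation fib_top :: "'o \<Rightarrow> 'p" where
  "fib_top A \<equiv> \<top>\<^bsub>Fib P A\<^esub>"

lemma
  assumes A: "A \<in> Obj (Base P)"
  shows fib_refl: "x \<in> fib A \<Longrightarrow> x \<preceq>\<^bsub>A\<^esub> x"
    and fib_trans: "x \<preceq>\<^bsub>A\<^esub> y \<Longrightarrow> y \<preceq>\<^bsub>A\<^esub> z \<Longrightarrow> x \<in> fib A \<Longrightarrow> y \<in> fib A \<Longrightarrow> z \<in> fib A \<Longrightarrow> x \<preceq>\<^bsub>A\<^esub> z"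
    and fib_antisym: "x \<preceq>\<^bsub>A\<^esub> y \<Longrightarrow> y \<preceq>\<^bsub>A\<^esub> x \<Longrightarrow> x \<in> fib A \<Longrightarrow> y \<in> fib A \<Longrightarrow> x = y"
    and meet_closed: "x \<in> fib A \<Longrightarrow> y \<in> fib A \<Longrightarrow> x \<and>\<^bsub>A\<^esub> y \<in> fib A"
    and meet_le1: "x \<in> fib A \<Longrightarrow> y \<in> fib A \<Longrightarrow> x \<and>\<^bsub>A\<^esub> y \<preceq>\<^bsub>A\<^esub> x"
    and meet_le2: "x \<in> fib A \<Longrightarrow> y \<in> fib A \<Longrightarrow> x \<and>\<^bsub>A\<^esub> y \<preceq>\<^bsub>A\<^esub> y"
    and le_meetI: "z \<preceq>\<^bsub>A\<^esub> x \<Longrightarrow> z \<preceq>\<^bsub>A\<^esub> y \<Longrightarrow> x \<in> fib A \<Longrightarrow> y \<in> fib A \<Longrightarrow> z \<in> fib A \<Longrightarrow> z \<preceq>\<^bsub>A\<^esub> x \<and>\<^bsub>A\<^esub> y"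
proof -
  interpret lower_semilattice "Fib P A" using A by (rule fibre_meets)
  show "x \<in> fib A \<Longrightarrow> x \<preceq>\<^bsub>A\<^esub> x" by simp
  show "x \<preceq>\<^bsub>A\<^esub> y \<Longrightarrow> y \<preceq>\<^bsub>A\<^esub> z \<Longrightarrow> x \<in> fib A \<Longrightarrow> y \<in> fib A \<Longrightarrow> z \<in> fib A \<Longrightarrow> x \<preceq>\<^bsub>A\<^esub> z"
    by (rule le_trans)
  show "x \<preceq>\<^bsub>A\<^esub> y \<Longrightarrow> y \<preceq>\<^bsub>A\<^esub> x \<Longrightarrow> x \<in> fib A \<Longrightarrow> y \<in> fib A \<Longrightarrow> x = y"
    by (rule le_antisym)
  show "x \<in> fib A \<Longrightarrow> y \<in> fib A \<Longrightarrow> x \<and>\<^bsub>A\<^esub> y \<in> fib A" by (rule meet_closed)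
  show "x \<in> fib A \<Longrightarrow> y \<in> fib A \<Longrightarrow> x \<and>\<^bsub>A\<^esub> y \<preceq>\<^bsub>A\<^esub> x" by (rule meet_left)
  show "x \<in> fib A \<Longrightarrow> y \<in> fib A \<Longrightarrow> x \<and>\<^bsub>A\<^esub> y \<preceq>\<^bsub>A\<^esub> y" by (rule meet_right)
  show "z \<preceq>\<^bsub>A\<^esub> x \<Longrightarrow> z \<preceq>\<^bsub>A\<^esub> y \<Longrightarrow> x \<in> fib A \<Longrightarrow> y \<in> fib A \<Longrightarrow> z \<in> fib A \<Longrightarrow> z \<preceq>\<^bsub>A\<^esub> x \<and>\<^bsub>A\<^esub> y"
    by (rule meet_le)
qed

lemma
  assumes A: "A \<in> Obj (Base P)"
  shows top_closed: "fib_top A \<in> fib A"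
    and le_top: "x \<in> fib A \<Longrightarrow> x \<preceq>\<^bsub>A\<^esub> fib_top A"
    and bot_closed: "fib_bot A \<in> fib A"
    and bot_le: "x \<in> fib A \<Longrightarrow> fib_bot A \<preceq>\<^bsub>A\<^esub> x"
proof -
  interpret T: weak_partial_order_top "Fib P A" using A by (rule fibre_top)
  interpret B: weak_partial_order_bottom "Fib P A" using A by (rule bounded.fibre_bottom)
  show "fib_top A \<in> fib A" "fib_bot A \<in> fib A" by simp_all
  show "x \<in> fib A \<Longrightarrow> x \<preceq>\<^bsub>A\<^esub> fib_top A" by (rule T.top_higher)
  show "x \<in> fib A \<Longrightarrow> fib_bot A \<preceq>\<^bsub>A\<^esub> x" by (rule B.bottom_lower)
qed

lemma
  assumes "A \<in> Obj (Base P)" "x \<in> fib A" "y \<in> fib A"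
  shows imp_closed: "x \<rightarrow>\<^bsub>A\<^esub> y \<in> fib A"
    and le_imp_iff: "z \<in> fib A \<Longrightarrow> z \<preceq>\<^bsub>A\<^esub> x \<rightarrow>\<^bsub>A\<^esub> y \<longleftrightarrow> z \<and>\<^bsub>A\<^esub> x \<preceq>\<^bsub>A\<^esub> y"
proof -
  have "is_himp (Fib P A) x y (x \<rightarrow>\<^bsub>A\<^esub> y)"
    unfolding himp_def using himp_exists[OF assms] by (rule someI_ex)
  then show "x \<rightarrow>\<^bsub>A\<^esub> y \<in> fib A" "z \<in> fib A \<Longrightarrow> z \<preceq>\<^bsub>A\<^esub> x \<rightarrow>\<^bsub>A\<^esub> y \<longleftrightarrow> z \<and>\<^bsub>A\<^esub> x \<preceq>\<^bsub>A\<^esub> y"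
    by (auto simp: is_himp_def)
qed

lemma Reidx_mem: "f \<in> Hom (Base P) A B \<Longrightarrow> x \<in> fib B \<Longrightarrow> Reidx P f x \<in> fib A"
  using Reidx_closed by blast

lemma Reidx_le:
  "f \<in> Hom (Base P) A B \<Longrightarrow> x \<in> fib B \<Longrightarrow> y \<in> fib B \<Longrightarrow> x \<preceq>\<^bsub>B\<^esub> y \<Longrightarrow> Reidx P f x \<preceq>\<^bsub>A\<^esub> Reidx P f y"
  using use_iso2[OF Reidx_mono] .

lemma
  assumes p: "is_product (Base P) X A B p q" and x: "x \<in> fib X"
  shows ex_closed: "ex P p x \<in> fib A"
    and ex_le_iff: "y \<in> fib A \<Longrightarrow> ex P p x \<preceq>\<^bsub>A\<^esub> y \<longleftrightarrow> x \<preceq>\<^bsub>X\<^esub> Reidx P p y"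
proof -
  have DC: "Dom (Base P) p = X" "Cod (Base P) p = A"
    using p by (auto simp: is_product_def Hom_def)
  have "is_left_adjoint P p (ex P p)"
    unfolding ex_def using left_adjoint_exists[OF p] by (rule someI_ex)
  then interpret galois_connection
    "\<lparr>orderA = Fib P X, orderB = Fib P A, lower = ex P p, upper = Reidx P p\<rparr>"
    by (simp add: is_left_adjoint_def DC)
  show "ex P p x \<in> fib A" "y \<in> fib A \<Longrightarrow> ex P p x \<preceq>\<^bsub>A\<^esub> y \<longleftrightarrow> x \<preceq>\<^bsub>X\<^esub> Reidx P p y"
    using lower_closed[of x] galois_property[of x y] x by simp_all
qed

text \<open>Adding a Henkin axiom \<open>\<exists>x. a(x) \<longrightarrow> a(c)\<close> for a fresh constant \<open>c\<close> is conservative.\<close>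

lemma henkin_conservative:
  assumes p: "is_product (Base P) X A B p q" and z: "z \<in> fib A" and a: "a \<in> fib X"
    and le: "Reidx P p z \<and>\<^bsub>X\<^esub> (Reidx P p (ex P p a) \<rightarrow>\<^bsub>X\<^esub> a) \<preceq>\<^bsub>X\<^esub> fib_bot X"
  shows "Reidx P p z \<preceq>\<^bsub>X\<^esub> fib_bot X"
proof -
  have X: "X \<in> Obj (Base P)" and A: "A \<in> Obj (Base P)" and pH: "p \<in> Hom (Base P) X A"
    using p base.product_Obj[OF p] by (auto simp: is_product_def)
  define e where "e = ex P p a"
  define z' where "z' = Reidx P p z"
  define e' where "e' = Reidx P p e"
  define b where "b = fib_bot X"
  have e: "e \<in> fib A" unfolding e_def using p a by (rule ex_closed)
  have cl: "z' \<in> fib X" "e' \<in> fib X" "b \<in> fib X"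
    using z e pH X by (auto simp: z'_def e'_def b_def Reidx_mem bot_closed)
  have i: "e' \<rightarrow>\<^bsub>X\<^esub> a \<in> fib X" using X cl a by (simp add: imp_closed)
  note cl' = cl a i meet_closed[OF X]
  \<comment> \<open>The hypothesis as a rule: whatever lies below both \<open>z'\<close> and the
    Henkin implication is absurd. It is used twice, first for \<open>a\<close> together with
    \<open>z'\<close>, then for \<open>z'\<close> alone.\<close>
  have le': "w \<preceq>\<^bsub>X\<^esub> b" if "w \<in> fib X" "w \<preceq>\<^bsub>X\<^esub> z'" "w \<preceq>\<^bsub>X\<^esub> e' \<rightarrow>\<^bsub>X\<^esub> a" for w
    by (rule fib_trans[OF X le_meetI[OF X that(2,3)] le[folded e_def z'_def e'_def b_def]])
      (use that cl' in auto)
  have "a \<preceq>\<^bsub>X\<^esub> z' \<rightarrow>\<^bsub>X\<^esub> b"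
  proof -
    have "a \<and>\<^bsub>X\<^esub> z' \<preceq>\<^bsub>X\<^esub> e' \<rightarrow>\<^bsub>X\<^esub> a"
      unfolding le_imp_iff[OF X cl(2) a cl'(6)[OF a cl(1)]]
      by (rule fib_trans[OF X meet_le1[OF X] meet_le1[OF X]]) (use cl' in auto)
    then have "a \<and>\<^bsub>X\<^esub> z' \<preceq>\<^bsub>X\<^esub> b" using cl' by (intro le') (auto simp: meet_le2[OF X])
    then show ?thesis using le_imp_iff[OF X cl(1,3) a] by simp
  qed
  \<comment> \<open>The negation of \<open>z'\<close> is reindexed from \<open>A\<close>, so the
    adjunction extends the refutation from \<open>a\<close> to the existential formula
    \<open>e\<close>.\<close>
  also have "z' \<rightarrow>\<^bsub>X\<^esub> b = Reidx P p (z \<rightarrow>\<^bsub>A\<^esub> fib_bot A)"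
    using Reidx_himp[OF pH z bot_closed[OF A]] bounded.Reidx_bottom[OF pH]
    by (simp add: z'_def b_def)
  finally have "e \<preceq>\<^bsub>A\<^esub> z \<rightarrow>\<^bsub>A\<^esub> fib_bot A"
    unfolding e_def by (subst ex_le_iff[OF p a]) (simp_all add: imp_closed A z bot_closed)
  then have "e' \<preceq>\<^bsub>X\<^esub> z' \<rightarrow>\<^bsub>X\<^esub> b"
    unfolding e'_def \<open>z' \<rightarrow>\<^bsub>X\<^esub> b = _\<close>
    by (rule Reidx_le[OF pH e, rotated]) (simp add: imp_closed A z bot_closed)
  then have *: "e' \<and>\<^bsub>X\<^esub> z' \<preceq>\<^bsub>X\<^esub> b" using le_imp_iff[OF X cl(1,3,2)] by simp
  have "z' \<and>\<^bsub>X\<^esub> e' \<preceq>\<^bsub>X\<^esub> e' \<and>\<^bsub>X\<^esub> z'"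
    by (rule le_meetI[OF X meet_le2[OF X] meet_le1[OF X]]) (use cl' in auto)
  then have "z' \<and>\<^bsub>X\<^esub> e' \<preceq>\<^bsub>X\<^esub> b" using * by (rule fib_trans[OF X]) (use cl' in auto)
  \<comment> \<open>From absurdity anything follows, in particular \<open>a\<close>; thus
    \<open>z'\<close> alone entails the Henkin implication.\<close>
  then have "z' \<and>\<^bsub>X\<^esub> e' \<preceq>\<^bsub>X\<^esub> a"
    by (rule fib_trans[OF X]) (use cl' X in \<open>auto simp: b_def bot_le\<close>)
  then have "z' \<preceq>\<^bsub>X\<^esub> e' \<rightarrow>\<^bsub>X\<^esub> a" using le_imp_iff[OF X cl(2) a cl(1)] by simp
  then have "z' \<preceq>\<^bsub>X\<^esub> b" using cl X by (intro le') (auto simp: fib_refl)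
  then show ?thesis by (simp add: z'_def b_def)
qed

end

locale heyting_contexts = heyting_doctrine P + contexts "Base P" \<sigma>
  for P :: "('o, 'a, 'p) doctrine" and \<sigma> :: "'k \<Rightarrow> 'o"
begin

section \<open>Formulas with constants, entailment and consistency\<close>

abbreviation wkf :: "'k set \<Rightarrow> 'k set \<Rightarrow> 'p \<Rightarrow> 'p" where
  "wkf S T \<equiv> Reidx P (wk S T)"

definition formulas :: "('k set \<times> 'p) set" where
  "formulas = {(T, \<phi>). finite T \<and> \<phi> \<in> fib (ctx T)}"

text \<open>The order of the filtered colimit of the fibres over the contexts, as a preorder on
  representatives in place of a quotient.\<close>

definition entails :: "'k set \<times> 'p \<Rightarrow> 'k set \<times> 'p \<Rightarrow> bool" where
  "entails x y \<longleftrightarrow> (\<exists>S. finite S \<and> fst x \<subseteq> S \<and> fst y \<subseteq> S \<and>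
    wkf S (fst x) (snd x) \<preceq>\<^bsub>ctx S\<^esub> wkf S (fst y) (snd y))"

text \<open>Being different from bottom in that colimit. All larger contexts must be inspected,
  since a formula may become absurd only after constants have been added.\<close>

definition consistent :: "'k set \<times> 'p \<Rightarrow> bool" where
  "consistent x \<longleftrightarrow> (\<forall>S. finite S \<longrightarrow> fst x \<subseteq> S \<longrightarrow>
    \<not> wkf S (fst x) (snd x) \<preceq>\<^bsub>ctx S\<^esub> fib_bot (ctx S))"

lemma wkf_closed: "finite S \<Longrightarrow> T \<subseteq> S \<Longrightarrow> \<phi> \<in> fib (ctx T) \<Longrightarrow> wkf S T \<phi> \<in> fib (ctx S)"
  using Reidx_mem[OF wk_Hom] .

lemma wkf_mono: "finite S \<Longrightarrow> T \<subseteq> S \<Longrightarrow> \<phi> \<in> fib (ctx T) \<Longrightarrow> \<psi> \<in> fib (ctx T) \<Longrightarrow>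
    \<phi> \<preceq>\<^bsub>ctx T\<^esub> \<psi> \<Longrightarrow> wkf S T \<phi> \<preceq>\<^bsub>ctx S\<^esub> wkf S T \<psi>"
  using Reidx_le[OF wk_Hom] .

lemma wkf_wkf:
  assumes "finite S" "T \<subseteq> S" "U \<subseteq> T" "\<phi> \<in> fib (ctx U)"
  shows "wkf S T (wkf T U \<phi>) = wkf S U \<phi>"
  using Reidx_Comp[OF wk_Hom[OF assms(1,2)] wk_Hom[OF finite_subset[OF assms(2,1)] assms(3)] assms(4)]
    Comp_wk_wk[OF assms(1-3)] by simp

lemma wkf_refl: "finite T \<Longrightarrow> \<phi> \<in> fib (ctx T) \<Longrightarrow> wkf T T \<phi> = \<phi>"
  by (simp add: wk_refl Reidx_Ide ctx_Obj)

lemma wkf_formula: "x \<in> formulas \<Longrightarrow> finite S \<Longrightarrow> fst x \<subseteq> S \<Longrightarrow> wkf S (fst x) (snd x) \<in> fib (ctx S)"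
  by (auto simp: formulas_def wkf_closed)

text \<open>An entailment persists over every later context. The extra set \<open>U\<close> lets the
  stage include an earlier one, so that two entailments can be compared over one context.\<close>

lemma entails_stage:
  assumes "entails x y" "x \<in> formulas" "y \<in> formulas" "finite U"
  obtains S where "finite S" "U \<subseteq> S" "fst x \<subseteq> S" "fst y \<subseteq> S"
    "\<And>S'. finite S' \<Longrightarrow> S \<subseteq> S' \<Longrightarrow> wkf S' (fst x) (snd x) \<preceq>\<^bsub>ctx S'\<^esub> wkf S' (fst y) (snd y)"
proof -
  obtain S where S: "finite S" "fst x \<subseteq> S" "fst y \<subseteq> S"
    "wkf S (fst x) (snd x) \<preceq>\<^bsub>ctx S\<^esub> wkf S (fst y) (snd y)"
    using assms by (auto simp: entails_def)
  show ?thesis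
  proof (rule that[of "S \<union> U"])
    fix S' assume S': "finite S'" "S \<union> U \<subseteq> S'"
    have xy: "snd x \<in> fib (ctx (fst x))" "snd y \<in> fib (ctx (fst y))"
      using assms by (auto simp: formulas_def)
    have "wkf S' S (wkf S (fst x) (snd x)) \<preceq>\<^bsub>ctx S'\<^esub> wkf S' S (wkf S (fst y) (snd y))"
      using S S' xy by (intro wkf_mono wkf_closed) auto
    then show "wkf S' (fst x) (snd x) \<preceq>\<^bsub>ctx S'\<^esub> wkf S' (fst y) (snd y)"
      using S S' xy by (simp add: wkf_wkf)
  qed (use S assms in auto)
qed

lemma entails_trans:
  assumes xy: "entails x y" and yz: "entails y z"
    and fml: "x \<in> formulas" "y \<in> formulas" "z \<in> formulas"
  shows "entails x z"
proof -
  obtain S where S: "finite S" "fst x \<subseteq> S" "fst y \<subseteq> S"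
    "\<And>S'. finite S' \<Longrightarrow> S \<subseteq> S' \<Longrightarrow> wkf S' (fst x) (snd x) \<preceq>\<^bsub>ctx S'\<^esub> wkf S' (fst y) (snd y)"
    using entails_stage[OF xy fml(1,2), of "{}"] by auto
  obtain S' where S': "finite S'" "S \<subseteq> S'" "fst y \<subseteq> S'" "fst z \<subseteq> S'"
    "\<And>S''. finite S'' \<Longrightarrow> S' \<subseteq> S'' \<Longrightarrow> wkf S'' (fst y) (snd y) \<preceq>\<^bsub>ctx S''\<^esub> wkf S'' (fst z) (snd z)"
    using entails_stage[OF yz fml(2,3) S(1)] by metis
  have x: "fst x \<subseteq> S'" using S(2) S'(2) by blast
  have "wkf S' (fst x) (snd x) \<preceq>\<^bsub>ctx S'\<^esub> wkf S' (fst z) (snd z)"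
    using fib_trans[OF ctx_Obj[OF S'(1)] S(4)[OF S'(1,2)] S'(5)[OF S'(1) order_refl]]
      wkf_formula[OF fml(1) S'(1) x] wkf_formula[OF fml(2) S'(1,3)] wkf_formula[OF fml(3) S'(1,4)]
    by blast
  then show ?thesis using S'(1,4) x by (auto simp: entails_def)
qed

lemma entails_iff_wkf:
  assumes "finite S" "T \<subseteq> S" "\<phi> \<in> fib (ctx T)"
  shows "entails (T, \<phi>) (S, wkf S T \<phi>)" "entails (S, wkf S T \<phi>) (T, \<phi>)"
  using assms
  by (auto simp: entails_def wkf_refl wkf_closed fib_refl ctx_Obj intro!: exI[of _ S])

lemma entails_of_le:
  assumes "finite T" "\<phi> \<in> fib (ctx T)" "\<psi> \<in> fib (ctx T)" "\<phi> \<preceq>\<^bsub>ctx T\<^esub> \<psi>"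
  shows "entails (T, \<phi>) (T, \<psi>)"
  using assms by (auto simp: entails_def intro!: exI[of _ T] wkf_mono)

lemma entails_meetI:
  assumes "entails x (T, \<phi>)" "entails x (T, \<psi>)"
    and fml: "x \<in> formulas" "(T, \<phi>) \<in> formulas" "(T, \<psi>) \<in> formulas"
  shows "entails x (T, \<phi> \<and>\<^bsub>ctx T\<^esub> \<psi>)"
proof -
  have cl: "finite T" "\<phi> \<in> fib (ctx T)" "\<psi> \<in> fib (ctx T)" "snd x \<in> fib (ctx (fst x))"
    using fml by (auto simp: formulas_def)
  obtain S where S: "finite S" "fst x \<subseteq> S" "T \<subseteq> S"
    "\<And>S'. finite S' \<Longrightarrow> S \<subseteq> S' \<Longrightarrow> wkf S' (fst x) (snd x) \<preceq>\<^bsub>ctx S'\<^esub> wkf S' T \<phi>"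
    using entails_stage[OF assms(1) fml(1,2) finite.emptyI, unfolded fst_conv snd_conv] by metis
  obtain S' where S': "finite S'" "S \<subseteq> S'"
    "\<And>S''. finite S'' \<Longrightarrow> S' \<subseteq> S'' \<Longrightarrow> wkf S'' (fst x) (snd x) \<preceq>\<^bsub>ctx S''\<^esub> wkf S'' T \<psi>"
    using entails_stage[OF assms(2) fml(1,3) S(1), unfolded fst_conv snd_conv] by metis
  have sub: "fst x \<subseteq> S'" "T \<subseteq> S'" using S S' by auto
  have "wkf S' (fst x) (snd x) \<preceq>\<^bsub>ctx S'\<^esub> wkf S' T \<phi> \<and>\<^bsub>ctx S'\<^esub> wkf S' T \<psi>"
    using le_meetI[OF ctx_Obj[OF S'(1)] S(4)[OF S'(1,2)] S'(3)[OF S'(1) order_refl]]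
      wkf_formula[OF fml(1) S'(1) sub(1)] wkf_closed[OF S'(1) sub(2) cl(2)]
      wkf_closed[OF S'(1) sub(2) cl(3)]
    by blast
  also have "wkf S' T \<phi> \<and>\<^bsub>ctx S'\<^esub> wkf S' T \<psi> = wkf S' T (\<phi> \<and>\<^bsub>ctx T\<^esub> \<psi>)"
    using Reidx_meet[OF wk_Hom[OF S'(1) sub(2)] cl(2,3)] by simp
  finally show ?thesis using S'(1) sub by (auto simp: entails_def)
qed

lemma not_consistent_bot:
  assumes "consistent x" "finite T" shows "\<not> entails x (T, fib_bot (ctx T))"
proof
  assume "entails x (T, fib_bot (ctx T))"
  then obtain S where S: "finite S" "fst x \<subseteq> S" "T \<subseteq> S"
    "wkf S (fst x) (snd x) \<preceq>\<^bsub>ctx S\<^esub> wkf S T (fib_bot (ctx T))"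
    by (auto simp: entails_def)
  then show False using assms bounded.Reidx_bottom[OF wk_Hom[OF S(1,3)]]
    by (auto simp: consistent_def)
qed

text \<open>The meet of \<open>x\<close> and \<phi>, formed over a common context, is below both and
  hence inconsistent. So it is bottom over some larger context, where the implication adjunction
  turns this into the claim.\<close>

lemma entails_negI:
  assumes x: "x \<in> formulas" and T: "finite T" "\<phi> \<in> fib (ctx T)"
    and incompatible: "\<And>z. z \<in> formulas \<Longrightarrow> consistent z \<Longrightarrow> entails z x \<Longrightarrow> \<not> entails z (T, \<phi>)"
  shows "entails x (T, \<phi> \<rightarrow>\<^bsub>ctx T\<^esub> fib_bot (ctx T))"
proof -
  obtain U \<xi> where x_eq: "x = (U, \<xi>)" and U: "finite U" "\<xi> \<in> fib (ctx U)"
    using x by (auto simp: formulas_def)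
  define S where "S = U \<union> T"
  have S: "finite S" "U \<subseteq> S" "T \<subseteq> S" using U T by (auto simp: S_def)
  define m where "m = wkf S U \<xi> \<and>\<^bsub>ctx S\<^esub> wkf S T \<phi>"
  have cl: "wkf S U \<xi> \<in> fib (ctx S)" "wkf S T \<phi> \<in> fib (ctx S)"
    using S U T by (auto intro!: wkf_closed)
  then have m: "m \<in> fib (ctx S)" using S by (simp add: m_def meet_closed ctx_Obj)
  have fml: "(S, m) \<in> formulas" "(S, wkf S U \<xi>) \<in> formulas" "(S, wkf S T \<phi>) \<in> formulas"
    "(T, \<phi>) \<in> formulas" using S m cl T by (auto simp: formulas_def)
  have "entails (S, m) (S, wkf S U \<xi>)" "entails (S, m) (S, wkf S T \<phi>)"
    using S m cl by (auto intro!: entails_of_le simp: m_def meet_le1 meet_le2 ctx_Obj)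
  then have "entails (S, m) x" "entails (S, m) (T, \<phi>)"
    using entails_trans fml entails_iff_wkf(2) S U T x unfolding x_eq by blast+
  then have "\<not> consistent (S, m)" using incompatible fml by blast
  then obtain S' where S': "finite S'" "S \<subseteq> S'" "wkf S' S m \<preceq>\<^bsub>ctx S'\<^esub> fib_bot (ctx S')"
    by (auto simp: consistent_def)
  have sub: "U \<subseteq> S'" "T \<subseteq> S'" using S S' by auto
  have cl': "wkf S' U \<xi> \<in> fib (ctx S')" "wkf S' T \<phi> \<in> fib (ctx S')"
    using S' sub U T by (auto intro!: wkf_closed)
  have "wkf S' S m = wkf S' U \<xi> \<and>\<^bsub>ctx S'\<^esub> wkf S' T \<phi>"
    using Reidx_meet[OF wk_Hom[OF S'(1,2)] cl] S S' U T by (simp add: m_def wkf_wkf)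
  with S'(3) have "wkf S' U \<xi> \<preceq>\<^bsub>ctx S'\<^esub> wkf S' T \<phi> \<rightarrow>\<^bsub>ctx S'\<^esub> fib_bot (ctx S')"
    using le_imp_iff[OF ctx_Obj cl'(2) bot_closed cl'(1)] S' by (simp add: ctx_Obj)
  also have "\<dots> = wkf S' T (\<phi> \<rightarrow>\<^bsub>ctx T\<^esub> fib_bot (ctx T))"
    using Reidx_himp[OF wk_Hom[OF S'(1) sub(2)] T(2) bot_closed]
      bounded.Reidx_bottom[OF wk_Hom[OF S'(1) sub(2)]] T(1) by (simp add: ctx_Obj)
  finally show ?thesis using S' sub by (auto simp: entails_def x_eq)
qed

end

text \<open>In terms of the colimit of the fibres, this is an ultrafilter: closure under
  \<open>entails\<close> makes membership independent of representatives, and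
  \<open>\<Gamma>_negI\<close> stands in for primeness, there being no disjunction.\<close>

locale complete_theory = heyting_contexts P \<sigma>
  for P :: "('o, 'a, 'p) doctrine" and \<sigma> :: "'k \<Rightarrow> 'o" +
  fixes \<Gamma> :: "('k set \<times> 'p) set"
  assumes \<Gamma>_formulas: "\<Gamma> \<subseteq> formulas"
    and \<Gamma>_entails: "x \<in> \<Gamma> \<Longrightarrow> y \<in> formulas \<Longrightarrow> entails x y \<Longrightarrow> y \<in> \<Gamma>"
    and \<Gamma>_top: "finite T \<Longrightarrow> (T, fib_top (ctx T)) \<in> \<Gamma>"
    and \<Gamma>_bot: "finite T \<Longrightarrow> (T, fib_bot (ctx T)) \<notin> \<Gamma>"
    and \<Gamma>_meetI: "(T, \<phi>) \<in> \<Gamma> \<Longrightarrow> (T, \<psi>) \<in> \<Gamma> \<Longrightarrow> (T, \<phi> \<and>\<^bsub>ctx T\<^esub> \<psi>) \<in> \<Gamma>"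
    and \<Gamma>_negI: "(T, \<phi>) \<in> formulas \<Longrightarrow> (T, \<phi>) \<notin> \<Gamma> \<Longrightarrow> (T, \<phi> \<rightarrow>\<^bsub>ctx T\<^esub> fib_bot (ctx T)) \<in> \<Gamma>"
begin

lemma \<Gamma>_memD: "(T, \<phi>) \<in> \<Gamma> \<Longrightarrow> finite T" "(T, \<phi>) \<in> \<Gamma> \<Longrightarrow> \<phi> \<in> fib (ctx T)"
  using \<Gamma>_formulas by (auto simp: formulas_def)

lemma \<Gamma>_le:
  assumes "(T, \<phi>) \<in> \<Gamma>" "\<psi> \<in> fib (ctx T)" "\<phi> \<preceq>\<^bsub>ctx T\<^esub> \<psi>"
  shows "(T, \<psi>) \<in> \<Gamma>"
  by (rule \<Gamma>_entails[OF assms(1) _ entails_of_le[OF \<Gamma>_memD[OF assms(1)] assms(2,3)]])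
    (simp add: formulas_def assms(2) \<Gamma>_memD(1)[OF assms(1)])

lemma \<Gamma>_wkf_iff:
  assumes "finite S" "T \<subseteq> S" "\<phi> \<in> fib (ctx T)"
  shows "(S, wkf S T \<phi>) \<in> \<Gamma> \<longleftrightarrow> (T, \<phi>) \<in> \<Gamma>"
proof
  have "(S, wkf S T \<phi>) \<in> formulas" "(T, \<phi>) \<in> formulas"
    using assms finite_subset[OF assms(2,1)] by (simp_all add: formulas_def wkf_closed)
  then show "(S, wkf S T \<phi>) \<in> \<Gamma> \<Longrightarrow> (T, \<phi>) \<in> \<Gamma>" "(T, \<phi>) \<in> \<Gamma> \<Longrightarrow> (S, wkf S T \<phi>) \<in> \<Gamma>"
    using \<Gamma>_entails entails_iff_wkf[OF assms] by blast+
qed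

lemma \<Gamma>_meet_iff:
  assumes T: "finite T" and \<phi>: "\<phi> \<in> fib (ctx T)" and \<psi>: "\<psi> \<in> fib (ctx T)"
  shows "(T, \<phi> \<and>\<^bsub>ctx T\<^esub> \<psi>) \<in> \<Gamma> \<longleftrightarrow> (T, \<phi>) \<in> \<Gamma> \<and> (T, \<psi>) \<in> \<Gamma>"
  using \<Gamma>_meetI \<Gamma>_le[OF _ \<phi> meet_le1[OF ctx_Obj[OF T] \<phi> \<psi>]]
    \<Gamma>_le[OF _ \<psi> meet_le2[OF ctx_Obj[OF T] \<phi> \<psi>]] by blast

text \<open>The classical case is the one where \<phi> is not in the theory: completeness then
  supplies its negation, which entails every implication out of \<phi>.\<close>

lemma \<Gamma>_imp_iff:
  assumes T: "finite T" and \<phi>: "\<phi> \<in> fib (ctx T)" and \<psi>: "\<psi> \<in> fib (ctx T)"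
  shows "(T, \<phi> \<rightarrow>\<^bsub>ctx T\<^esub> \<psi>) \<in> \<Gamma> \<longleftrightarrow> ((T, \<phi>) \<in> \<Gamma> \<longrightarrow> (T, \<psi>) \<in> \<Gamma>)"
proof
  let ?X = "ctx T"
  have X: "?X \<in> Obj (Base P)" using T by (rule ctx_Obj)
  have b: "fib_bot ?X \<in> fib ?X" using X by (rule bot_closed)
  have i: "\<phi> \<rightarrow>\<^bsub>?X\<^esub> \<psi> \<in> fib ?X" using X \<phi> \<psi> by (rule imp_closed)
  {
    assume imp: "(T, \<phi> \<rightarrow>\<^bsub>?X\<^esub> \<psi>) \<in> \<Gamma>"
    have "(\<phi> \<rightarrow>\<^bsub>?X\<^esub> \<psi>) \<and>\<^bsub>?X\<^esub> \<phi> \<preceq>\<^bsub>?X\<^esub> \<psi>"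
      using le_imp_iff[OF X \<phi> \<psi> i] fib_refl[OF X i] by simp
    then show "(T, \<phi>) \<in> \<Gamma> \<longrightarrow> (T, \<psi>) \<in> \<Gamma>"
      using \<Gamma>_meetI[OF imp] \<Gamma>_le \<psi> by blast
  next
    assume imp: "(T, \<phi>) \<in> \<Gamma> \<longrightarrow> (T, \<psi>) \<in> \<Gamma>"
    show "(T, \<phi> \<rightarrow>\<^bsub>?X\<^esub> \<psi>) \<in> \<Gamma>"
    proof (cases "(T, \<psi>) \<in> \<Gamma>")
      case True
      have "\<psi> \<preceq>\<^bsub>?X\<^esub> \<phi> \<rightarrow>\<^bsub>?X\<^esub> \<psi>"
        using le_imp_iff[OF X \<phi> \<psi> \<psi>] meet_le1[OF X \<psi> \<phi>] by simp
      with True i show ?thesis by (rule \<Gamma>_le)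
    next
      case False
      define n where "n = \<phi> \<rightarrow>\<^bsub>?X\<^esub> fib_bot ?X"
      have n: "n \<in> fib ?X" unfolding n_def using X \<phi> b by (rule imp_closed)
      have "n \<and>\<^bsub>?X\<^esub> \<phi> \<preceq>\<^bsub>?X\<^esub> fib_bot ?X"
        using le_imp_iff[OF X \<phi> b n] fib_refl[OF X n] by (simp add: n_def)
      then have "n \<and>\<^bsub>?X\<^esub> \<phi> \<preceq>\<^bsub>?X\<^esub> \<psi>"
        using bot_le[OF X \<psi>] by (rule fib_trans[OF X]) (use n \<phi> \<psi> b X in \<open>auto intro: meet_closed\<close>)
      then have "n \<preceq>\<^bsub>?X\<^esub> \<phi> \<rightarrow>\<^bsub>?X\<^esub> \<psi>"
        using le_imp_iff[OF X \<phi> \<psi> n] by simp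
      moreover have "(T, n) \<in> \<Gamma>"
        unfolding n_def using False imp T \<phi> by (intro \<Gamma>_negI) (auto simp: formulas_def)
      ultimately show ?thesis using i \<Gamma>_le by blast
    qed
  }
qed

end

text \<open>All closure conditions are instances of closure under finite sets of premises. For
  negation, an excluded \<phi> is incompatible with a finite part \<Delta> of \<Gamma>; by
  \<open>entails_negI\<close>, whatever lies below \<Delta> then lies below the negation of
  \<phi>.\<close>

lemma (in heyting_contexts) complete_theory_exists:
  assumes "compatible formulas entails consistent H"
  obtains \<Gamma> where "H \<subseteq> \<Gamma>" "complete_theory P \<sigma> \<Gamma>"
proof -
  obtain \<Gamma> where H: "H \<subseteq> \<Gamma>" and \<Gamma>: "compatible formulas entails consistent \<Gamma>"
    and closed: "\<And>x \<Delta>. x \<in> formulas \<Longrightarrow> \<Delta> \<subseteq> \<Gamma> \<Longrightarrow> finite \<Delta> \<Longrightarrow>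
      (\<And>z. z \<in> formulas \<Longrightarrow> consistent z \<Longrightarrow> \<forall>y\<in>\<Delta>. entails z y \<Longrightarrow> entails z x) \<Longrightarrow> x \<in> \<Gamma>"
    and incompatible: "\<And>x. x \<in> formulas \<Longrightarrow> x \<notin> \<Gamma> \<Longrightarrow> \<exists>\<Delta>. \<Delta> \<subseteq> \<Gamma> \<and> finite \<Delta> \<and>
      (\<forall>z\<in>formulas. consistent z \<longrightarrow> (\<forall>y\<in>\<Delta>. entails z y) \<longrightarrow> \<not> entails z x)"
    using maximal_compatible_exists[OF assms] by blast
  have fml: "\<Gamma> \<subseteq> formulas" using \<Gamma> by (simp add: compatible_def)
  have "complete_theory P \<sigma> \<Gamma>"
  proof
    show "\<Gamma> \<subseteq> formulas" by fact
    show "y \<in> \<Gamma>" if "x \<in> \<Gamma>" "y \<in> formulas" "entails x y" for x y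
      by (rule closed[of y "{x}"]) (use that fml entails_trans[OF _ that(3)] in blast)+
    fix T :: "'k set" and \<phi> \<psi>
    show "(T, fib_top (ctx T)) \<in> \<Gamma>" if T: "finite T"
    proof (rule closed[of _ "{}"])
      have X: "ctx T \<in> Obj (Base P)" using T by (rule ctx_Obj)
      then show "(T, fib_top (ctx T)) \<in> formulas" using T by (simp add: formulas_def top_closed)
      fix z assume z: "z \<in> formulas"
      \<comment> \<open>The formula \<open>z\<close> and top live over unrelated contexts and are
        compared over the union.\<close>
      let ?S = "fst z \<union> T"
      have S: "finite ?S" "T \<subseteq> ?S" "fst z \<subseteq> ?S" using z T by (auto simp: formulas_def)
      show "entails z (T, fib_top (ctx T))"
        unfolding entails_def
        by (rule exI[of _ ?S]) (use z S Reidx_top[OF wk_Hom[OF S(1,2)]] in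
          \<open>auto simp: formulas_def intro!: le_top ctx_Obj wkf_closed\<close>)
    qed auto
    show "(T, fib_bot (ctx T)) \<notin> \<Gamma>" if T: "finite T"
    proof
      assume "(T, fib_bot (ctx T)) \<in> \<Gamma>"
      then obtain z where "consistent z" "entails z (T, fib_bot (ctx T))"
        using compatibleD[OF \<Gamma>, of "{(T, fib_bot (ctx T))}"] by auto
      then show False using not_consistent_bot T by blast
    qed
    show "(T, \<phi> \<and>\<^bsub>ctx T\<^esub> \<psi>) \<in> \<Gamma>" if mem: "(T, \<phi>) \<in> \<Gamma>" "(T, \<psi>) \<in> \<Gamma>"
    proof (rule closed[of _ "{(T, \<phi>), (T, \<psi>)}"])
      have fml': "(T, \<phi>) \<in> formulas" "(T, \<psi>) \<in> formulas" using mem fml by auto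
      then have "finite T" "\<phi> \<in> fib (ctx T)" "\<psi> \<in> fib (ctx T)" by (auto simp: formulas_def)
      then show "(T, \<phi> \<and>\<^bsub>ctx T\<^esub> \<psi>) \<in> formulas"
        using meet_closed[OF ctx_Obj[of T]] by (simp add: formulas_def)
      show "entails z (T, \<phi> \<and>\<^bsub>ctx T\<^esub> \<psi>)"
        if "z \<in> formulas" "\<forall>y\<in>{(T, \<phi>), (T, \<psi>)}. entails z y" for z
        by (rule entails_meetI) (use that fml' in auto)
    qed (use mem in auto)
    show "(T, \<phi> \<rightarrow>\<^bsub>ctx T\<^esub> fib_bot (ctx T)) \<in> \<Gamma>" if \<phi>: "(T, \<phi>) \<in> formulas" "(T, \<phi>) \<notin> \<Gamma>"
    proof -
      have T: "finite T" "\<phi> \<in> fib (ctx T)" using \<phi> by (auto simp: formulas_def)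
      obtain \<Delta> where \<Delta>: "\<Delta> \<subseteq> \<Gamma>" "finite \<Delta>"
        "\<And>z. z \<in> formulas \<Longrightarrow> consistent z \<Longrightarrow> \<forall>y\<in>\<Delta>. entails z y \<Longrightarrow> \<not> entails z (T, \<phi>)"
        using incompatible[OF \<phi>] by blast
      show ?thesis
      proof (rule closed[OF _ \<Delta>(1,2)])
        show "(T, \<phi> \<rightarrow>\<^bsub>ctx T\<^esub> fib_bot (ctx T)) \<in> formulas"
          using T by (simp add: formulas_def imp_closed bot_closed ctx_Obj)
        fix z assume z: "z \<in> formulas" "\<forall>y\<in>\<Delta>. entails z y"
        show "entails z (T, \<phi> \<rightarrow>\<^bsub>ctx T\<^esub> fib_bot (ctx T))"
        proof (rule entails_negI[OF z(1) T])
          fix w assume w: "w \<in> formulas" "consistent w" "entails w z"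
          have "\<forall>y\<in>\<Delta>. entails w y"
            using entails_trans[OF w(3) _ w(1) z(1)] z(2) \<Delta>(1) fml by blast
          then show "\<not> entails w (T, \<phi>)" using \<Delta>(3) w by blast
        qed
      qed
    qed
  qed
  with H that show ?thesis by blast
qed

section \<open>The term model of a Henkin theory\<close>

text \<open>Only two consequences of the Henkin constants are kept: every sort has a term, and a
  true existential formula has a witnessing term. In \<open>witness\<close>, \<open>s\<close>
  consists of the weakened context together with the witness, whence the equation on its first
  projection. The injection \<open>code\<close> places terms in the universe.\<close>

locale henkin_theory = complete_theory P \<sigma> \<Gamma>
  for P :: "('o, 'a, 'p) doctrine" and \<sigma> :: "'k \<Rightarrow> 'o" and \<Gamma> +
  fixes code :: "'k set \<times> 'a \<Rightarrow> 'u"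
  assumes infinite_universe: "infinite (UNIV :: 'u set)"
    and code_inj: "inj_on code ({T. finite T} \<times> Arr (Base P))"
    and inhabited: "B \<in> Obj (Base P) \<Longrightarrow> \<exists>T t. finite T \<and> t \<in> Hom (Base P) (ctx T) B"
    and witness: "finite T \<Longrightarrow> is_product (Base P) X (ctx T) B p q \<Longrightarrow> \<alpha> \<in> fib X \<Longrightarrow>
      (T, ex P p \<alpha>) \<in> \<Gamma> \<Longrightarrow> \<exists>S s. finite S \<and> T \<subseteq> S \<and> s \<in> Hom (Base P) (ctx S) X \<and>
        Comp (Base P) p s = wk S T \<and> (S, Reidx P s \<alpha>) \<in> \<Gamma>"
begin

section \<open>Terms, their identification and the elements of the model\<close>

definition terms :: "'o \<Rightarrow> ('k set \<times> 'a) set" where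
  "terms B = {(T, t). finite T \<and> t \<in> Hm (ctx T) B}"

definition term_eq :: "'k set \<times> 'a \<Rightarrow> 'k set \<times> 'a \<Rightarrow> bool" where
  "term_eq x y \<longleftrightarrow> (\<exists>S. finite S \<and> fst x \<subseteq> S \<and> fst y \<subseteq> S \<and> snd x \<cdot> wk S (fst x) = snd y \<cdot> wk S (fst y))"

lemma terms_iff: "(T, t) \<in> terms B \<longleftrightarrow> finite T \<and> t \<in> Hm (ctx T) B"
  by (simp add: terms_def)

lemma term_wk:
  assumes "(T, t) \<in> terms B" "finite S" "T \<subseteq> S"
  shows "(S, t \<cdot> wk S T) \<in> terms B"
  using assms base.Comp_Hom[OF wk_Hom] by (auto simp: terms_iff)

lemma term_wk_wk:
  assumes "(T, t) \<in> terms B" "finite S'" "S \<subseteq> S'" "T \<subseteq> S"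
  shows "t \<cdot> wk S T \<cdot> wk S' S = t \<cdot> wk S' T"
proof -
  have "t \<cdot> (wk S T \<cdot> wk S' S) = t \<cdot> wk S T \<cdot> wk S' S"
    using assms finite_subset[OF assms(3,2)]
    by (intro base.Comp_assoc[OF wk_Hom wk_Hom]) (auto simp: terms_iff)
  then show ?thesis using assms by (simp add: Comp_wk_wk)
qed

lemma term_eq_stage:
  assumes "term_eq x y" "x \<in> terms A" "y \<in> terms B"
  obtains S where "finite S" "fst x \<subseteq> S" "fst y \<subseteq> S"
    "\<And>S'. finite S' \<Longrightarrow> S \<subseteq> S' \<Longrightarrow> snd x \<cdot> wk S' (fst x) = snd y \<cdot> wk S' (fst y)"
proof -
  obtain S where S: "finite S" "fst x \<subseteq> S" "fst y \<subseteq> S" "snd x \<cdot> wk S (fst x) = snd y \<cdot> wk S (fst y)"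
    using assms(1) by (auto simp: term_eq_def)
  have "snd x \<cdot> wk S' (fst x) = snd y \<cdot> wk S' (fst y)" if "finite S'" "S \<subseteq> S'" for S'
    using term_wk_wk[of "fst x" "snd x" A S' S] term_wk_wk[of "fst y" "snd y" B S' S] S that assms(2,3)
    by simp
  with S that show ?thesis by blast
qed

lemma term_eq_refl: "x \<in> terms B \<Longrightarrow> term_eq x x"
  unfolding term_eq_def by (rule exI[of _ "fst x"]) (auto simp: terms_def)

lemma term_eq_sym: "term_eq x y \<Longrightarrow> term_eq y x"
  by (auto simp: term_eq_def)

lemma term_eq_trans:
  assumes xy: "term_eq x y" and yz: "term_eq y z"
    and x: "x \<in> terms A" and y: "y \<in> terms B" and z: "z \<in> terms D"
  shows "term_eq x z"
proof -
  obtain S where S: "finite S" "fst x \<subseteq> S" "fst y \<subseteq> S"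
    "\<And>S'. finite S' \<Longrightarrow> S \<subseteq> S' \<Longrightarrow> snd x \<cdot> wk S' (fst x) = snd y \<cdot> wk S' (fst y)"
    using term_eq_stage[OF xy x y] by metis
  obtain S' where S': "finite S'" "fst y \<subseteq> S'" "fst z \<subseteq> S'"
    "\<And>S. finite S \<Longrightarrow> S' \<subseteq> S \<Longrightarrow> snd y \<cdot> wk S (fst y) = snd z \<cdot> wk S (fst z)"
    using term_eq_stage[OF yz y z] by metis
  have "snd x \<cdot> wk (S \<union> S') (fst x) = snd z \<cdot> wk (S \<union> S') (fst z)"
    using S(4)[of "S \<union> S'"] S'(4)[of "S \<union> S'"] S(1) S'(1) by simp
  then show ?thesis
    unfolding term_eq_def using S(1,2) S'(1,3) by (intro exI[of _ "S \<union> S'"]) auto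
qed

text \<open>A class of terms is a set of terms and no element of the universe, so a chosen
  representative is coded instead. The sort can be left open because terms identified by
  \<open>term_eq\<close> have equal weakenings and so the same codomain.\<close>

definition cls :: "'k set \<times> 'a \<Rightarrow> 'u" where
  "cls x = code (SOME y. (\<exists>B. y \<in> terms B) \<and> term_eq x y)"

lemma cls_eq_iff:
  assumes x: "x \<in> terms A" and y: "y \<in> terms B"
  shows "cls x = cls y \<longleftrightarrow> term_eq x y"
proof
  let ?r = "\<lambda>x. SOME y. (\<exists>B. y \<in> terms B) \<and> term_eq x y"
  have r: "(\<exists>B. ?r x \<in> terms B) \<and> term_eq x (?r x)" if "x \<in> terms A" for x A
    by (rule someI_ex) (use that term_eq_refl in blast)
  have dom: "x \<in> {T. finite T} \<times> Arr (Base P)" if "x \<in> terms A" for x A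
    using that by (auto simp: terms_def Hom_def)
  {
    assume "cls x = cls y"
    then have "code (?r x) = code (?r y)" by (simp add: cls_def)
    then have eq: "?r x = ?r y"
      using inj_onD[OF code_inj] dom r[OF x] r[OF y] by blast
    obtain D where D: "?r x \<in> terms D" using r[OF x] by blast
    have "term_eq x (?r x)" "term_eq (?r x) y"
      using r[OF x] r[OF y] eq by (auto intro: term_eq_sym)
    then show "term_eq x y" using x D y by (rule term_eq_trans)
  next
    assume xy: "term_eq x y"
    \<comment> \<open>Equivalent terms define the same predicate, so \<open>SOME\<close> picks the
      same representative for both.\<close>
    have "(\<exists>B. z \<in> terms B) \<and> term_eq x z \<longleftrightarrow> (\<exists>B. z \<in> terms B) \<and> term_eq y z" for z
      using term_eq_trans[OF xy _ x y] term_eq_trans[OF term_eq_sym[OF xy] _ y x] by blast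
    then show "cls x = cls y" by (simp add: cls_def)
  }
qed

lemma cls_wk:
  assumes "(T, t) \<in> terms B" "finite S" "T \<subseteq> S"
  shows "cls (S, t \<cdot> wk S T) = cls (T, t)"
proof -
  have "term_eq (S, t \<cdot> wk S T) (T, t)"
    unfolding term_eq_def fst_conv snd_conv
    using assms term_wk_wk[OF assms(1,2) order_refl assms(3)] by (intro exI[of _ S]) auto
  then show ?thesis using cls_eq_iff[OF term_wk[OF assms] assms(1)] by simp
qed

definition elems :: "'o \<Rightarrow> 'u set" where
  "elems B = cls ` terms B"

lemma cls_elems: "(T, t) \<in> terms B \<Longrightarrow> cls (T, t) \<in> elems B"
  by (simp add: elems_def)

lemma elemsE:
  assumes "u \<in> elems B"
  obtains T t where "(T, t) \<in> terms B" "u = cls (T, t)"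
  using assms by (auto simp: elems_def)

text \<open>Filteredness of the system of contexts: both terms are weakened to the union of their
  contexts.\<close>

lemma elems_common_ctx:
  assumes "u \<in> elems A" "v \<in> elems B"
  obtains T s t where "(T, s) \<in> terms A" "u = cls (T, s)" "(T, t) \<in> terms B" "v = cls (T, t)"
proof -
  obtain S s where s: "(S, s) \<in> terms A" "u = cls (S, s)" using assms(1) by (rule elemsE)
  obtain T t where t: "(T, t) \<in> terms B" "v = cls (T, t)" using assms(2) by (rule elemsE)
  have fin: "finite (S \<union> T)" "S \<subseteq> S \<union> T" "T \<subseteq> S \<union> T" using s t by (auto simp: terms_iff)
  show ?thesis
    using that[of "S \<union> T" "s \<cdot> wk (S \<union> T) S" "t \<cdot> wk (S \<union> T) T"]
      term_wk[OF s(1) fin(1,2)] term_wk[OF t(1) fin(1,3)] cls_wk[OF s(1) fin(1,2)] cls_wk[OF t(1) fin(1,3)]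
      s t by simp
qed

section \<open>The product-preserving functor to non-empty sets\<close>

definition arr :: "'a \<Rightarrow> 'u set_arrow" where
  "arr f = (elems (Dom (Base P) f),
    (\<lambda>u\<in>elems (Dom (Base P) f). let (T, t) = SOME x. x \<in> terms (Dom (Base P) f) \<and> cls x = u in cls (T, f \<cdot> t)),
    elems (Cod (Base P) f))"

lemma term_Comp: "f \<in> Hm A B \<Longrightarrow> (T, t) \<in> terms A \<Longrightarrow> (T, f \<cdot> t) \<in> terms B"
  using base.Comp_Hom by (auto simp: terms_iff)

text \<open>Independence of the representative: terms that agree over a larger context
  \<open>U\<close> still agree there after composition with \<open>f\<close>.\<close>

lemma arr_cls:
  assumes f: "f \<in> Hm A B" and t: "(T, t) \<in> terms A"
  shows "set_fun (arr f) (cls (T, t)) = cls (T, f \<cdot> t)"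
proof -
  have D: "Dom (Base P) f = A" using f by (simp add: Hom_def)
  let ?x = "SOME x. x \<in> terms A \<and> cls x = cls (T, t)"
  have x: "?x \<in> terms A \<and> cls ?x = cls (T, t)"
    by (rule someI[of _ "(T, t)"]) (use t in simp)
  obtain S s where s: "?x = (S, s)" by fastforce
  have sx: "(S, s) \<in> terms A" "cls (S, s) = cls (T, t)" using x s by auto
  then obtain U where U: "finite U" "S \<subseteq> U" "T \<subseteq> U" "s \<cdot> wk U S = t \<cdot> wk U T"
    using cls_eq_iff[OF sx(1) t] by (auto simp: term_eq_def)
  have "f \<cdot> s \<cdot> wk U S = f \<cdot> (s \<cdot> wk U S)"
    using base.Comp_assoc[OF wk_Hom[OF U(1,2)] _ f] sx(1) by (simp add: terms_iff)
  also have "\<dots> = f \<cdot> t \<cdot> wk U T"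
    using base.Comp_assoc[OF wk_Hom[OF U(1,3)] _ f] t U(4) by (simp add: terms_iff)
  finally have "cls (S, f \<cdot> s) = cls (T, f \<cdot> t)"
    using cls_eq_iff[OF term_Comp[OF f sx(1)] term_Comp[OF f t]] U by (auto simp: term_eq_def)
  then show ?thesis using cls_elems[OF t] s by (simp add: arr_def D)
qed

lemma arr_Hom:
  assumes f: "f \<in> Hm A B"
  shows "arr f \<in> Hom Set_star (elems A) (elems B)"
proof -
  have DC: "Dom (Base P) f = A" "Cod (Base P) f = B" using f by (auto simp: Hom_def)
  \<comment> \<open>Objects of \<open>Set_star\<close> are non-empty, so a term of sort
    \<open>A\<close> has to be supplied.\<close>
  obtain T t where "finite T" "t \<in> Hm (ctx T) A"
    using inhabited base.Hom_Obj[OF f] by blast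
  then have ne: "elems A \<noteq> {}" using cls_elems[of T t A] by (auto simp: terms_iff)
  obtain \<phi> where \<phi>: "arr f = (elems A, restrict \<phi> (elems A), elems B)"
    by (simp add: arr_def DC)
  have "\<phi> u \<in> elems B" if u: "u \<in> elems A" for u
  proof -
    obtain T t where t: "(T, t) \<in> terms A" "u = cls (T, t)" using u by (rule elemsE)
    then show ?thesis using arr_cls[OF f t(1)] cls_elems[OF term_Comp[OF f t(1)]] u \<phi> by simp
  qed
  then show ?thesis unfolding \<phi> by (intro restrict_in_Hom_Set_star ne)
qed

lemma elems_nonempty: "A \<in> Obj (Base P) \<Longrightarrow> elems A \<noteq> {}"
  using arr_Hom[OF base.Ide_Hom, of A] by (simp add: Hom_Set_star)

lemma arr_Comp:
  assumes f: "f \<in> Hm A B" and g: "g \<in> Hm B D"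
  shows "arr (g \<cdot> f) = Comp Set_star (arr g) (arr f)"
proof (rule set_arrow_eqI[OF arr_Hom[OF base.Comp_Hom[OF f g]] Comp_Hom_Set_star[OF arr_Hom[OF f] arr_Hom[OF g]]])
  fix u assume u: "u \<in> elems A"
  then obtain T t where t: "(T, t) \<in> terms A" "u = cls (T, t)" by (rule elemsE)
  have "g \<cdot> f \<cdot> t = g \<cdot> (f \<cdot> t)"
    using base.Comp_assoc[OF _ f g, of t "ctx T"] t by (simp add: terms_iff)
  then show "set_fun (arr (g \<cdot> f)) u = set_fun (Comp Set_star (arr g) (arr f)) u"
    unfolding set_fun_Comp[OF arr_Hom[OF f] arr_Hom[OF g] u]
    by (simp add: t(2) arr_cls[OF f t(1)] arr_cls[OF g term_Comp[OF f t(1)]]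
      arr_cls[OF base.Comp_Hom[OF f g] t(1)])
qed

lemma arr_Ide:
  assumes "A \<in> Obj (Base P)"
  shows "arr (Ide (Base P) A) = Ide Set_star (elems A)"
proof (rule set_arrow_eqI[OF arr_Hom[OF base.Ide_Hom[OF assms]] category.Ide_Hom[OF category_Set_star]])
  show "elems A \<in> Obj Set_star" using elems_nonempty[OF assms] by simp
  fix u assume u: "u \<in> elems A"
  then obtain T t where t: "(T, t) \<in> terms A" "u = cls (T, t)" by (rule elemsE)
  have "Ide (Base P) A \<cdot> t = t" using base.Comp_Ide_left t by (auto simp: terms_iff)
  then show "set_fun (arr (Ide (Base P) A)) u = set_fun (Ide Set_star (elems A)) u"
    using arr_cls[OF base.Ide_Hom[OF assms] t(1)] t u by simp
qed

text \<open>Finite products commute with filtered colimits. Two components can be represented over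
  one context and paired there, and the two equations on components can be brought to one context,
  where product uniqueness applies.\<close>

lemma product_functor_elems: "product_functor (Base P) Set_star elems arr"
proof (intro product_functor.intro product_functor_axioms.intro)
  show "finite_product_category (Base P)" by (rule base)
  show "finite_product_category (Set_star :: ('u set, 'u set_arrow) cat)"
    by (rule finite_product_category_Set_star[OF infinite_universe])
  show "elems A \<in> Obj Set_star" if "A \<in> Obj (Base P)" for A
    using elems_nonempty that by simp
  show "arr f \<in> Hom Set_star (elems A) (elems B)" if "f \<in> Hm A B" for f A B
    using that by (rule arr_Hom)
  show "arr (Ide (Base P) A) = Ide Set_star (elems A)" if "A \<in> Obj (Base P)" for A
    using that by (rule arr_Ide)
  show "arr (g \<cdot> f) = Comp Set_star (arr g) (arr f)" if "f \<in> Hm A B" "g \<in> Hm B E" for f g A B E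
    using that by (rule arr_Comp)
  show "is_terminal Set_star (elems I)" if I: "is_terminal (Base P) I" for I
  proof -
    have I_Obj: "I \<in> Obj (Base P)" using I by (simp add: is_terminal_def)
    have "u = v" if uv: "u \<in> elems I" "v \<in> elems I" for u v
    proof -
      obtain T s t where st: "(T, s) \<in> terms I" "u = cls (T, s)" "(T, t) \<in> terms I" "v = cls (T, t)"
        using uv by (rule elems_common_ctx)
      then have "\<exists>!f. f \<in> Hm (ctx T) I" using I ctx_Obj by (simp add: is_terminal_def terms_iff)
      then have "s = t" using st by (auto simp: terms_iff)
      then show ?thesis using st by simp
    qed
    moreover obtain u where "u \<in> elems I" using elems_nonempty[OF I_Obj] by blast
    ultimately have "elems I = {u}" by blast
    then show ?thesis by (simp add: is_terminal_singleton)
  qed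
  show "is_product Set_star (elems X) (elems A) (elems B) (arr p) (arr q)"
    if X: "is_product (Base P) X A B p q" for X A B p q
    unfolding is_product_Set_star
  proof (intro conjI ballI)
    have p: "p \<in> Hm X A" and q: "q \<in> Hm X B" using X by (auto simp: is_product_def)
    show "arr p \<in> Hom Set_star (elems X) (elems A)" "arr q \<in> Hom Set_star (elems X) (elems B)"
      using p q by (auto intro: arr_Hom)
    fix a b assume ab: "a \<in> elems A" "b \<in> elems B"
    obtain T s t where st: "(T, s) \<in> terms A" "a = cls (T, s)" "(T, t) \<in> terms B" "b = cls (T, t)"
      using ab by (rule elems_common_ctx)
    then have T: "finite T" "s \<in> Hm (ctx T) A" "t \<in> Hm (ctx T) B" by (auto simp: terms_iff)
    obtain h where h: "h \<in> Hm (ctx T) X" "p \<cdot> h = s" "q \<cdot> h = t"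
      using base.product_pair[OF X T(2,3)] by blast
    have hX: "(T, h) \<in> terms X" using T h by (simp add: terms_iff)
    show "\<exists>!x. x \<in> elems X \<and> set_fun (arr p) x = a \<and> set_fun (arr q) x = b"
    proof
      show "cls (T, h) \<in> elems X \<and> set_fun (arr p) (cls (T, h)) = a \<and> set_fun (arr q) (cls (T, h)) = b"
        using cls_elems[OF hX] arr_cls[OF p hX] arr_cls[OF q hX] h st by simp
      fix x assume x: "x \<in> elems X \<and> set_fun (arr p) x = a \<and> set_fun (arr q) x = b"
      then obtain S k where k: "(S, k) \<in> terms X" "x = cls (S, k)" using elemsE by blast
      have "cls (S, p \<cdot> k) = cls (T, p \<cdot> h)" "cls (S, q \<cdot> k) = cls (T, q \<cdot> h)"
        using x k arr_cls[OF p k(1)] arr_cls[OF q k(1)] h st by auto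
      then have eq: "term_eq (S, p \<cdot> k) (T, p \<cdot> h)" "term_eq (S, q \<cdot> k) (T, q \<cdot> h)"
        using cls_eq_iff term_Comp[OF p] term_Comp[OF q] k(1) hX by blast+
      obtain U where U: "finite U" "S \<subseteq> U" "T \<subseteq> U"
        "\<And>U'. finite U' \<Longrightarrow> U \<subseteq> U' \<Longrightarrow> p \<cdot> k \<cdot> wk U' S = p \<cdot> h \<cdot> wk U' T"
        using term_eq_stage[OF eq(1) term_Comp[OF p k(1)] term_Comp[OF p hX], unfolded fst_conv snd_conv]
        by metis
      obtain V where V: "finite V" "S \<subseteq> V" "T \<subseteq> V"
        "\<And>U'. finite U' \<Longrightarrow> V \<subseteq> U' \<Longrightarrow> q \<cdot> k \<cdot> wk U' S = q \<cdot> h \<cdot> wk U' T"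
        using term_eq_stage[OF eq(2) term_Comp[OF q k(1)] term_Comp[OF q hX], unfolded fst_conv snd_conv]
        by metis
      let ?W = "U \<union> V"
      have W: "finite ?W" "S \<subseteq> ?W" "T \<subseteq> ?W" "U \<subseteq> ?W" "V \<subseteq> ?W" using U V by auto
      have kH: "k \<in> Hm (ctx S) X" using k by (simp add: terms_iff)
      note kW = wk_Hom[OF W(1,2)] and hW = wk_Hom[OF W(1,3)]
      have "k \<cdot> wk ?W S = h \<cdot> wk ?W T"
      proof (rule base.product_eqI[OF X base.Comp_Hom[OF kW kH] base.Comp_Hom[OF hW h(1)]])
        show "p \<cdot> (k \<cdot> wk ?W S) = p \<cdot> (h \<cdot> wk ?W T)"
          using U(4)[OF W(1,4)] base.Comp_assoc[OF kW kH p] base.Comp_assoc[OF hW h(1) p] by simp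
        show "q \<cdot> (k \<cdot> wk ?W S) = q \<cdot> (h \<cdot> wk ?W T)"
          using V(4)[OF W(1,5)] base.Comp_assoc[OF kW kH q] base.Comp_assoc[OF hW h(1) q] by simp
      qed
      then have "cls (S, k) = cls (T, h)"
        using cls_wk[OF k(1) W(1,2)] cls_wk[OF hX W(1,3)] by simp
      then show "x = cls (T, h)" using k by simp
    qed
  qed
qed

section \<open>Truth in the term model\<close>

definition val :: "'o \<Rightarrow> 'p \<Rightarrow> 'u set" where
  "val B \<beta> = cls ` {(T, t) \<in> terms B. (T, Reidx P t \<beta>) \<in> \<Gamma>}"

text \<open>Truth does not depend on the representing term: identified terms reindex the formula to
  the same element over some \<open>U\<close>, and weakening to \<open>U\<close> does not affect
  membership in the theory.\<close>

lemma cls_val_iff: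
  assumes t: "(T, t) \<in> terms B" and \<beta>: "\<beta> \<in> fib B"
  shows "cls (T, t) \<in> val B \<beta> \<longleftrightarrow> (T, Reidx P t \<beta>) \<in> \<Gamma>"
proof
  assume "cls (T, t) \<in> val B \<beta>"
  then obtain S s where s: "(S, s) \<in> terms B" "(S, Reidx P s \<beta>) \<in> \<Gamma>" "cls (S, s) = cls (T, t)"
    by (auto simp: val_def)
  then obtain U where U: "finite U" "S \<subseteq> U" "T \<subseteq> U" "s \<cdot> wk U S = t \<cdot> wk U T"
    using cls_eq_iff[OF s(1) t] by (auto simp: term_eq_def)
  have sH: "s \<in> Hm (ctx S) B" and tH: "t \<in> Hm (ctx T) B" using s t by (auto simp: terms_iff)
  have "wkf U S (Reidx P s \<beta>) = wkf U T (Reidx P t \<beta>)"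
    using Reidx_Comp[OF wk_Hom[OF U(1,2)] sH \<beta>] Reidx_Comp[OF wk_Hom[OF U(1,3)] tH \<beta>] U(4) by simp
  then show "(T, Reidx P t \<beta>) \<in> \<Gamma>"
    using s(2) \<Gamma>_wkf_iff[OF U(1,2) Reidx_mem[OF sH \<beta>]] \<Gamma>_wkf_iff[OF U(1,3) Reidx_mem[OF tH \<beta>]]
    by simp
qed (use t in \<open>auto simp: val_def\<close>)

lemma val_elems: "val B \<beta> \<subseteq> elems B"
  by (auto simp: val_def elems_def)

lemma val_eqI:
  assumes "V \<subseteq> elems B" "\<beta> \<in> fib B"
    "\<And>T t. (T, t) \<in> terms B \<Longrightarrow> (T, Reidx P t \<beta>) \<in> \<Gamma> \<longleftrightarrow> cls (T, t) \<in> V"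
  shows "val B \<beta> = V"
proof (rule Set.set_eqI)
  fix u
  show "u \<in> val B \<beta> \<longleftrightarrow> u \<in> V"
  proof (cases "u \<in> elems B")
    case True
    then obtain T t where "(T, t) \<in> terms B" "u = cls (T, t)" by (rule elemsE)
    then show ?thesis using cls_val_iff assms(2,3) by blast
  qed (use assms(1) val_elems in blast)
qed

lemma val_Reidx:
  assumes f: "f \<in> Hm A B" and \<beta>: "\<beta> \<in> fib B"
  shows "val A (Reidx P f \<beta>) = {a \<in> elems A. set_fun (arr f) a \<in> val B \<beta>}"
proof (rule val_eqI[OF _ Reidx_mem[OF f \<beta>]])
  fix T t assume t: "(T, t) \<in> terms A"
  then have "Reidx P t (Reidx P f \<beta>) = Reidx P (f \<cdot> t) \<beta>"
    using Reidx_Comp[OF _ f \<beta>, of t "ctx T"] by (simp add: terms_iff)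
  then show "(T, Reidx P t (Reidx P f \<beta>)) \<in> \<Gamma> \<longleftrightarrow> cls (T, t) \<in> {a \<in> elems A. set_fun (arr f) a \<in> val B \<beta>}"
    using cls_val_iff[OF term_Comp[OF f t] \<beta>] arr_cls[OF f t] cls_elems[OF t] by simp
qed auto

lemma val_mono:
  assumes A: "A \<in> Obj (Base P)" and cl: "\<alpha> \<in> fib A" "\<beta> \<in> fib A" and le: "\<alpha> \<preceq>\<^bsub>A\<^esub> \<beta>"
  shows "val A \<alpha> \<subseteq> val A \<beta>"
proof
  fix u assume u: "u \<in> val A \<alpha>"
  then obtain T t where t: "(T, t) \<in> terms A" "(T, Reidx P t \<alpha>) \<in> \<Gamma>" "u = cls (T, t)"
    by (auto simp: val_def)
  have tH: "t \<in> Hm (ctx T) A" using t by (simp add: terms_iff)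
  have "(T, Reidx P t \<beta>) \<in> \<Gamma>"
    by (rule \<Gamma>_le[OF t(2) Reidx_mem[OF tH cl(2)] Reidx_le[OF tH cl le]])
  then show "u \<in> val A \<beta>" using t cls_val_iff cl by simp
qed

lemma val_top: "A \<in> Obj (Base P) \<Longrightarrow> val A (fib_top A) = elems A"
  by (rule val_eqI) (auto simp: top_closed terms_iff Reidx_top \<Gamma>_top intro!: cls_elems)

lemma val_bot: "A \<in> Obj (Base P) \<Longrightarrow> val A (fib_bot A) = {}"
  by (rule val_eqI) (auto simp: bot_closed terms_iff bounded.Reidx_bottom \<Gamma>_bot)

lemma val_meet:
  assumes "A \<in> Obj (Base P)" "\<alpha> \<in> fib A" "\<beta> \<in> fib A"
  shows "val A (\<alpha> \<and>\<^bsub>A\<^esub> \<beta>) = val A \<alpha> \<inter> val A \<beta>"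
proof (rule val_eqI[OF _ meet_closed[OF assms]])
  show "val A \<alpha> \<inter> val A \<beta> \<subseteq> elems A" using val_elems by blast
  fix T t assume t: "(T, t) \<in> terms A"
  then have T: "finite T" and tH: "t \<in> Hm (ctx T) A" by (auto simp: terms_iff)
  show "(T, Reidx P t (\<alpha> \<and>\<^bsub>A\<^esub> \<beta>)) \<in> \<Gamma> \<longleftrightarrow> cls (T, t) \<in> val A \<alpha> \<inter> val A \<beta>"
    using \<Gamma>_meet_iff[OF T Reidx_mem[OF tH assms(2)] Reidx_mem[OF tH assms(3)]]
    by (simp add: Reidx_meet[OF tH assms(2,3)] cls_val_iff[OF t] assms)
qed

lemma val_imp:
  assumes "A \<in> Obj (Base P)" "\<alpha> \<in> fib A" "\<beta> \<in> fib A"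
  shows "val A (\<alpha> \<rightarrow>\<^bsub>A\<^esub> \<beta>) = (elems A - val A \<alpha>) \<union> val A \<beta>"
proof (rule val_eqI[OF _ imp_closed[OF assms]])
  show "(elems A - val A \<alpha>) \<union> val A \<beta> \<subseteq> elems A" using val_elems by blast
  fix T t assume t: "(T, t) \<in> terms A"
  then have T: "finite T" and tH: "t \<in> Hm (ctx T) A" by (auto simp: terms_iff)
  show "(T, Reidx P t (\<alpha> \<rightarrow>\<^bsub>A\<^esub> \<beta>)) \<in> \<Gamma> \<longleftrightarrow> cls (T, t) \<in> (elems A - val A \<alpha>) \<union> val A \<beta>"
    using \<Gamma>_imp_iff[OF T Reidx_mem[OF tH assms(2)] Reidx_mem[OF tH assms(3)]] cls_elems[OF t]
    by (auto simp: Reidx_himp[OF tH assms(2,3)] cls_val_iff[OF t] assms)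
qed

text \<open>The image is contained in the left-hand side by the unit of the adjunction. Conversely,
  Beck-Chevalley along a term \<open>t\<close> replaces the quantifier over \<open>A\<close> by one
  over the context of \<open>t\<close>, where the Henkin witness is available.\<close>

lemma val_ex:
  assumes X: "is_product (Base P) X A B p q" and \<alpha>: "\<alpha> \<in> fib X"
  shows "val A (ex P p \<alpha>) = set_fun (arr p) ` val X \<alpha>"
proof
  have p: "p \<in> Hm X A" and q: "q \<in> Hm X B" using X by (auto simp: is_product_def)
  have A: "A \<in> Obj (Base P)" "X \<in> Obj (Base P)" "B \<in> Obj (Base P)" using base.product_Obj[OF X] by auto
  have e: "ex P p \<alpha> \<in> fib A" using X \<alpha> by (rule ex_closed)
  have "\<alpha> \<preceq>\<^bsub>X\<^esub> Reidx P p (ex P p \<alpha>)"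
    using ex_le_iff[OF X \<alpha> e] fib_refl[OF A(1) e] by simp
  then have "val X \<alpha> \<subseteq> val X (Reidx P p (ex P p \<alpha>))"
    using A(2) \<alpha> e p by (intro val_mono) (auto intro: Reidx_mem)
  then show "set_fun (arr p) ` val X \<alpha> \<subseteq> val A (ex P p \<alpha>)"
    unfolding val_Reidx[OF p e] by auto
  show "val A (ex P p \<alpha>) \<subseteq> set_fun (arr p) ` val X \<alpha>"
  proof
    fix u assume "u \<in> val A (ex P p \<alpha>)"
    then obtain T t where t: "(T, t) \<in> terms A" "(T, Reidx P t (ex P p \<alpha>)) \<in> \<Gamma>" "u = cls (T, t)"
      by (auto simp: val_def)
    have T: "finite T" and tH: "t \<in> Hm (ctx T) A" using t by (auto simp: terms_iff)
    \<comment> \<open>A product of the context with \<open>B\<close>: the arrow \<open>h\<close>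
      below is \<open>t\<close> times the identity of \<open>B\<close>, as Beck-Chevalley
      demands.\<close>
    obtain Z p' q' where Z: "is_product (Base P) Z (ctx T) B p' q'"
      using base.product_exists[OF ctx_Obj[OF T] A(3)] by blast
    have p': "p' \<in> Hm Z (ctx T)" and q': "q' \<in> Hm Z B" using Z by (auto simp: is_product_def)
    obtain h where h: "h \<in> Hm Z X" "p \<cdot> h = t \<cdot> p'" "q \<cdot> h = q'"
      using base.product_pair[OF X base.Comp_Hom[OF p' tH] q'] by blast
    have "ex P p' (Reidx P h \<alpha>) = Reidx P t (ex P p \<alpha>)"
      using Z X tH h \<alpha> by (rule Beck_Chevalley)
    with t(2) have "(T, ex P p' (Reidx P h \<alpha>)) \<in> \<Gamma>" by simp
    from witness[OF T Z Reidx_mem[OF h(1) \<alpha>] this] obtain S s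
      where S: "finite S" "T \<subseteq> S" "s \<in> Hm (ctx S) Z" "p' \<cdot> s = wk S T"
        "(S, Reidx P s (Reidx P h \<alpha>)) \<in> \<Gamma>"
      by blast
    have hs: "(S, h \<cdot> s) \<in> terms X" using S base.Comp_Hom[OF S(3) h(1)] by (simp add: terms_iff)
    have "cls (S, h \<cdot> s) \<in> val X \<alpha>"
      using cls_val_iff[OF hs \<alpha>] S(5) Reidx_Comp[OF S(3) h(1) \<alpha>] by simp
    \<comment> \<open>The witness projects to the weakening of \<open>t\<close>, which represents
      the same element \<open>u\<close>.\<close>
    moreover have "p \<cdot> (h \<cdot> s) = t \<cdot> wk S T"
      using base.Comp_assoc[OF S(3) h(1) p] base.Comp_assoc[OF S(3) p' tH] h(2) S(4) by simp
    then have "set_fun (arr p) (cls (S, h \<cdot> s)) = u"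
      using arr_cls[OF p hs] cls_wk[OF t(1) S(1,2)] t(3) by simp
    ultimately show "u \<in> set_fun (arr p) ` val X \<alpha>" by blast
  qed
qed

section \<open>The term model as a doctrine morphism\<close>

definition model :: "('o, 'a, 'p, 'u set, 'u set_arrow, 'u set) morphism" where
  "model = \<lparr>ObjMap = elems, ArrMap = arr, FibMap = val\<rparr>"

lemma doctrine_morphism_model: "doctrine_morphism P subsets_doctrine model"
proof (intro doctrine_morphism.intro doctrine_morphism_axioms.intro)
  show "doctrine P" by (rule doctrine_axioms)
  show "doctrine (subsets_doctrine :: ('u set, _, _) doctrine)"
    using infinite_universe by (rule doctrine_subsets)
  show "product_functor (Base P) (Base subsets_doctrine) (ObjMap model) (ArrMap model)"
    using product_functor_elems by (simp add: model_def)
  fix A assume A: "A \<in> Obj (Base P)"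
  show "FibMap model A \<in> fib A \<rightarrow> carrier (Fib subsets_doctrine (ObjMap model A))"
    using val_elems by (auto simp: model_def)
  show "isotone (Fib P A) (Fib subsets_doctrine (ObjMap model A)) (FibMap model A)"
    using val_mono[OF A]
    by (intro isotoneI partial_order.axioms(1)[OF fibre[OF A]] partial_order.axioms(1)[OF partial_order_subsets])
      (simp add: model_def)
next
  fix f A B \<alpha> assume f: "f \<in> Hm A B" and \<alpha>: "\<alpha> \<in> fib B"
  show "FibMap model A (Reidx P f \<alpha>) = Reidx subsets_doctrine (ArrMap model f) (FibMap model B \<alpha>)"
    using val_Reidx[OF f \<alpha>] Reidx_subsets[OF arr_Hom[OF f]] by (simp add: model_def)
qed

lemma primary_morphism_model: "primary_morphism P subsets_doctrine model"
  by (intro primary_morphism.intro primary_morphism_axioms.intro doctrine_morphism_model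
      primary_doctrine_axioms primary_subsets infinite_universe)
    (simp_all add: model_def val_top val_meet val_elems)

lemma bounded_morphism_model: "bounded_morphism P subsets_doctrine model"
  by (intro bounded_morphism.intro bounded_morphism_axioms.intro doctrine_morphism_model
      bounded.bounded_doctrine_axioms bounded_subsets infinite_universe)
    (simp_all add: model_def val_top val_bot)

lemma implicational_morphism_model: "implicational_morphism P subsets_doctrine model"
  by (intro implicational_morphism.intro implicational_morphism_axioms.intro primary_morphism_model
      implicational_doctrine_axioms implicational_subsets infinite_universe)
    (simp add: model_def val_imp val_elems)

lemma existential_morphism_model: "existential_morphism P subsets_doctrine model"
proof (intro existential_morphism.intro existential_morphism_axioms.intro primary_morphism_model
    existential_doctrine_axioms existential_subsets infinite_universe)
  fix X A B p q \<alpha> assume X: "is_product (Base P) X A B p q" and \<alpha>: "\<alpha> \<in> fib X"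
  then have p: "p \<in> Hm X A" by (simp add: is_product_def)
  show "FibMap model A (ex P p \<alpha>) = ex subsets_doctrine (ArrMap model p) (FibMap model X \<alpha>)"
    using val_ex[OF X \<alpha>] ex_subsets[OF arr_Hom[OF p] val_elems] by (simp add: model_def)
qed

end

section \<open>Henkin constants\<close>

text \<open>A constant \<open>(n, u)\<close> of level \<open>n\<close> is a witness for the existential formula with code \<open>u\<close>, so
  all constants of lower levels are available in that formula. Here \<open>(T, B, Z, \<alpha>)\<close> stands for
  \<open>\<exists>x : B. \<alpha>\<close> with constants in \<open>T\<close> when \<open>Z\<close> is the product of \<open>ctx T\<close> and \<open>B\<close>.\<close>

locale henkin_constants = heyting_contexts P \<sigma>
  for P :: "('o, 'a, 'p) doctrine" and \<sigma> :: "nat \<times> 'u \<Rightarrow> 'o" +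
  fixes code :: "(nat \<times> 'u) set \<times> 'o \<times> 'o \<times> 'p \<Rightarrow> 'u"
  assumes code_inj: "inj_on code ({T. finite T} \<times> Obj (Base P) \<times> Sigma (Obj (Base P)) (\<lambda>A. carrier (Fib P A)))"
    and sort_code: "finite T \<Longrightarrow> B \<in> Obj (Base P) \<Longrightarrow> Z \<in> Obj (Base P) \<Longrightarrow> \<alpha> \<in> carrier (Fib P Z) \<Longrightarrow>
      \<sigma> (n, code (T, B, Z, \<alpha>)) = B"
    and non_trivial: "A \<in> Obj (Base P) \<Longrightarrow> \<not> \<top>\<^bsub>Fib P A\<^esub> \<sqsubseteq>\<^bsub>Fib P A\<^esub> \<bottom>\<^bsub>Fib P A\<^esub>"
begin

text \<open>One product cone is fixed for each context and sort, so that each existential formula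
  has one definite form to be coded. Other cones are compared with it in
  \<open>henkin_witness\<close>.\<close>

definition ext_cone :: "(nat \<times> 'u) set \<Rightarrow> 'o \<Rightarrow> 'o \<times> 'a \<times> 'a" where
  "ext_cone T B = (SOME x. is_product (Base P) (fst x) (ctx T) B (fst (snd x)) (snd (snd x)))"

definition ext :: "(nat \<times> 'u) set \<Rightarrow> 'o \<Rightarrow> 'o" where "ext T B = fst (ext_cone T B)"

definition ext_fst :: "(nat \<times> 'u) set \<Rightarrow> 'o \<Rightarrow> 'a" where "ext_fst T B = fst (snd (ext_cone T B))"

definition ext_snd :: "(nat \<times> 'u) set \<Rightarrow> 'o \<Rightarrow> 'a" where "ext_snd T B = snd (snd (ext_cone T B))"

lemma ext_product:
  assumes "finite T" "B \<in> Obj (Base P)"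
  shows "is_product (Base P) (ext T B) (ctx T) B (ext_fst T B) (ext_snd T B)"
  using someI_ex[of "\<lambda>x. is_product (Base P) (fst x) (ctx T) B (fst (snd x)) (snd (snd x))"]
    base.product_exists[OF ctx_Obj[OF assms(1)] assms(2)]
  by (auto simp: ext_def ext_fst_def ext_snd_def ext_cone_def)

definition ex_formulas :: "((nat \<times> 'u) set \<times> 'o \<times> 'p) set" where
  "ex_formulas = {(T, B, \<alpha>). finite T \<and> B \<in> Obj (Base P) \<and> \<alpha> \<in> fib (ext T B)}"

text \<open>The inserted 0 gives \<open>Max\<close> a value on the empty context.\<close>

definition level :: "(nat \<times> 'u) set \<Rightarrow> nat" where
  "level T = Max (insert 0 (fst ` T))"

lemma level_ge: "finite T \<Longrightarrow> c \<in> T \<Longrightarrow> fst c \<le> level T"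
  unfolding level_def by (rule Max_ge) auto

text \<open>The successor puts the witness strictly above every constant of its context. The product
  object is part of the code because it determines the fibre to which \<alpha> belongs.\<close>

definition wit :: "(nat \<times> 'u) set \<times> 'o \<times> 'p \<Rightarrow> nat \<times> 'u" where
  "wit = (\<lambda>(T, B, \<alpha>). (Suc (level T), code (T, B, ext T B, \<alpha>)))"

lemma sort_wit: "(T, B, \<alpha>) \<in> ex_formulas \<Longrightarrow> \<sigma> (wit (T, B, \<alpha>)) = B"
  using base.product_Obj(1)[OF ext_product] by (simp add: wit_def ex_formulas_def sort_code)

lemma wit_fresh: "finite T \<Longrightarrow> level T \<le> level U \<Longrightarrow> wit (U, B, \<alpha>) \<notin> T"
  using level_ge[of T "wit (U, B, \<alpha>)"] by (auto simp: wit_def)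

lemma wit_inj:
  assumes "x \<in> ex_formulas" "y \<in> ex_formulas" "wit x = wit y" shows "x = y"
proof -
  obtain T B \<alpha> U D \<beta> where xy: "x = (T, B, \<alpha>)" "y = (U, D, \<beta>)" by (cases x, cases y) auto
  have "code (T, B, ext T B, \<alpha>) = code (U, D, ext U D, \<beta>)" using assms(3) by (simp add: xy wit_def)
  then have "(T, B, ext T B, \<alpha>) = (U, D, ext U D, \<beta>)"
    by (rule inj_onD[OF code_inj])
      (use assms(1,2) base.product_Obj(1)[OF ext_product] in \<open>auto simp: xy ex_formulas_def\<close>)
  then show ?thesis by (simp add: xy)
qed

abbreviation wctx :: "(nat \<times> 'u) set \<times> 'o \<times> 'p \<Rightarrow> (nat \<times> 'u) set" where
  "wctx x \<equiv> insert (wit x) (fst x)"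

text \<open>The substitution of the witness for the quantified variable: the pairing of the
  weakening to \<open>T\<close> with the projection onto the new constant. Reindexing \<alpha> along
  it gives the instance of \<alpha> at the witness.\<close>

definition inst :: "(nat \<times> 'u) set \<times> 'o \<times> 'p \<Rightarrow> 'a" where
  "inst = (\<lambda>(T, B, \<alpha>). SOME h. h \<in> Hm (ctx (wctx (T, B, \<alpha>))) (ext T B) \<and>
    ext_fst T B \<cdot> h = wk (wctx (T, B, \<alpha>)) T \<and>
    ext_snd T B \<cdot> h = var (wctx (T, B, \<alpha>)) (wit (T, B, \<alpha>)))"

lemma
  assumes x: "(T, B, \<alpha>) \<in> ex_formulas"
  shows inst_Hom: "inst (T, B, \<alpha>) \<in> Hm (ctx (wctx (T, B, \<alpha>))) (ext T B)"
    and ext_fst_inst: "ext_fst T B \<cdot> inst (T, B, \<alpha>) = wk (wctx (T, B, \<alpha>)) T"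
    and ext_snd_inst: "ext_snd T B \<cdot> inst (T, B, \<alpha>) = var (wctx (T, B, \<alpha>)) (wit (T, B, \<alpha>))"
proof -
  let ?W = "wctx (T, B, \<alpha>)"
  have T: "finite T" "B \<in> Obj (Base P)" and W: "finite ?W" "T \<subseteq> ?W"
    using x by (auto simp: ex_formulas_def)
  have "var ?W (wit (T, B, \<alpha>)) \<in> Hm (ctx ?W) B"
    using var_Hom[OF W(1), of "wit (T, B, \<alpha>)"] sort_wit[OF x] by simp
  then have "\<exists>h. h \<in> Hm (ctx ?W) (ext T B) \<and> ext_fst T B \<cdot> h = wk ?W T \<and>
      ext_snd T B \<cdot> h = var ?W (wit (T, B, \<alpha>))"
    using base.product_ex1[OF ext_product[OF T] wk_Hom[OF W]] by blast
  from someI_ex[OF this] show "inst (T, B, \<alpha>) \<in> Hm (ctx ?W) (ext T B)"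
    "ext_fst T B \<cdot> inst (T, B, \<alpha>) = wk ?W T"
    "ext_snd T B \<cdot> inst (T, B, \<alpha>) = var ?W (wit (T, B, \<alpha>))"
    by (simp_all add: inst_def)
qed

section \<open>Henkin axioms and their joint consistency\<close>

definition henkin_imp :: "(nat \<times> 'u) set \<times> 'o \<times> 'p \<Rightarrow> 'p" where
  "henkin_imp = (\<lambda>(T, B, \<alpha>). wkf (wctx (T, B, \<alpha>)) T (ex P (ext_fst T B) \<alpha>)
    \<rightarrow>\<^bsub>ctx (wctx (T, B, \<alpha>))\<^esub> Reidx P (inst (T, B, \<alpha>)) \<alpha>)"

definition henkin_axiom :: "(nat \<times> 'u) set \<times> 'o \<times> 'p \<Rightarrow> (nat \<times> 'u) set \<times> 'p" where
  "henkin_axiom x = (wctx x, henkin_imp x)"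

lemma henkin_parts:
  assumes x: "(T, B, \<alpha>) \<in> ex_formulas"
  shows "finite T" "B \<in> Obj (Base P)" "\<alpha> \<in> fib (ext T B)" "finite (wctx (T, B, \<alpha>))"
    "ex P (ext_fst T B) \<alpha> \<in> fib (ctx T)"
    "wkf (wctx (T, B, \<alpha>)) T (ex P (ext_fst T B) \<alpha>) \<in> fib (ctx (wctx (T, B, \<alpha>)))"
    "Reidx P (inst (T, B, \<alpha>)) \<alpha> \<in> fib (ctx (wctx (T, B, \<alpha>)))"
    "henkin_imp (T, B, \<alpha>) \<in> fib (ctx (wctx (T, B, \<alpha>)))"
proof -
  show T: "finite T" "B \<in> Obj (Base P)" "\<alpha> \<in> fib (ext T B)" "finite (wctx (T, B, \<alpha>))"
    using x by (auto simp: ex_formulas_def)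
  show e: "ex P (ext_fst T B) \<alpha> \<in> fib (ctx T)" using ex_closed[OF ext_product[OF T(1,2)] T(3)] .
  show e': "wkf (wctx (T, B, \<alpha>)) T (ex P (ext_fst T B) \<alpha>) \<in> fib (ctx (wctx (T, B, \<alpha>)))"
    by (rule wkf_closed[OF T(4) _ e]) auto
  show a: "Reidx P (inst (T, B, \<alpha>)) \<alpha> \<in> fib (ctx (wctx (T, B, \<alpha>)))"
    using inst_Hom[OF x] T(3) by (rule Reidx_mem)
  show "henkin_imp (T, B, \<alpha>) \<in> fib (ctx (wctx (T, B, \<alpha>)))"
    using imp_closed[OF ctx_Obj[OF T(4)] e' a] by (simp add: henkin_imp_def)
qed

lemma henkin_axiom_formula: "x \<in> ex_formulas \<Longrightarrow> henkin_axiom x \<in> formulas"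
  using henkin_parts by (cases x) (auto simp: henkin_axiom_def formulas_def)

text \<open>Any inconsistency of \<open>z\<close> with a Henkin axiom lives over a context containing the witness
  \<open>c\<close>, and that context is the product of one without \<open>c\<close> and the sort of \<open>c\<close>.\<close>

lemma henkin_axiom_conservative:
  assumes ex: "x \<in> ex_formulas" and U: "finite U" "fst x \<subseteq> U" "wit x \<notin> U"
    and z: "z \<in> fib (ctx U)" and S: "finite S" "U \<subseteq> S" "wctx x \<subseteq> S"
    and le: "wkf S U z \<and>\<^bsub>ctx S\<^esub> wkf S (wctx x) (henkin_imp x) \<preceq>\<^bsub>ctx S\<^esub> fib_bot (ctx S)"
  shows "wkf S U z \<preceq>\<^bsub>ctx S\<^esub> fib_bot (ctx S)"
proof -
  obtain T B \<alpha> where x_eq: "x = (T, B, \<alpha>)" by (cases x) auto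
  have x: "(T, B, \<alpha>) \<in> ex_formulas" using ex x_eq by simp
  note hp = henkin_parts[OF x]
  let ?c = "wit (T, B, \<alpha>)" and ?W = "wctx (T, B, \<alpha>)"
  have WS: "?W \<subseteq> S" and TU: "T \<subseteq> U" and cU: "?c \<notin> U" using S U x_eq by auto
  define S' where "S' = S - {?c}"
  have S': "finite S'" "U \<subseteq> S'" "T \<subseteq> S'" "?c \<notin> S'" "S = insert ?c S'" "S' \<subseteq> S"
    using S(1,2) WS TU cU by (auto simp: S'_def)
  have prod: "is_product (Base P) (ctx S) (ctx S') B (wk S S') (var S ?c)"
    using is_product_ctx_insert[OF S'(1,4)] sort_wit[OF x] by (simp add: S'(5)[symmetric])
  \<comment> \<open>This is the substitution seen from \<open>S\<close>, and also the arrow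
    \<open>wk S' T\<close> times the identity of \<open>B\<close>. Beck-Chevalley thus identifies
    the quantifier dropping the witness from \<open>S\<close> with the weakened original
    one.\<close>
  define h where "h = inst (T, B, \<alpha>) \<cdot> wk S ?W"
  have i: "inst (T, B, \<alpha>) \<in> Hm (ctx ?W) (ext T B)" by (rule inst_Hom[OF x])
  have w: "wk S ?W \<in> Hm (ctx S) (ctx ?W)" using S(1) WS by (rule wk_Hom)
  have h: "h \<in> Hm (ctx S) (ext T B)" unfolding h_def using w i by (rule base.Comp_Hom)
  have ext: "is_product (Base P) (ext T B) (ctx T) B (ext_fst T B) (ext_snd T B)"
    using hp(1,2) by (rule ext_product)
  then have pq: "ext_fst T B \<in> Hm (ext T B) (ctx T)" "ext_snd T B \<in> Hm (ext T B) B"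
    by (auto simp: is_product_def)
  have "ext_fst T B \<cdot> h = wk ?W T \<cdot> wk S ?W"
    unfolding h_def base.Comp_assoc[OF w i pq(1)] ext_fst_inst[OF x] ..
  also have "\<dots> = wk S T" by (rule Comp_wk_wk[OF S(1) WS]) auto
  also have "\<dots> = wk S' T \<cdot> wk S S'" by (rule Comp_wk_wk[OF S(1) S'(6,3), symmetric])
  finally have h1: "ext_fst T B \<cdot> h = wk S' T \<cdot> wk S S'" .
  have "ext_snd T B \<cdot> h = var ?W ?c \<cdot> wk S ?W"
    unfolding h_def base.Comp_assoc[OF w i pq(2)] ext_snd_inst[OF x] ..
  also have "\<dots> = var S ?c" by (rule var_wk[OF S(1) WS]) simp
  finally have h2: "ext_snd T B \<cdot> h = var S ?c" .
  define a where "a = Reidx P h \<alpha>"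
  have a: "a \<in> fib (ctx S)" unfolding a_def using h hp(3) by (rule Reidx_mem)
  have BC: "ex P (wk S S') a = wkf S' T (ex P (ext_fst T B) \<alpha>)"
    unfolding a_def using Beck_Chevalley[OF prod ext wk_Hom[OF S'(1,3)] h h1 h2 hp(3)] .
  have z': "wkf S' U z \<in> fib (ctx S')" using S'(1,2) z by (rule wkf_closed)
  \<comment> \<open>Over \<open>S\<close> the axiom takes the shape required by
    \<open>henkin_conservative\<close> for the projection from \<open>S\<close> to
    \<open>S'\<close>.\<close>
  have "wkf S ?W (henkin_imp (T, B, \<alpha>)) =
      wkf S ?W (wkf ?W T (ex P (ext_fst T B) \<alpha>)) \<rightarrow>\<^bsub>ctx S\<^esub> wkf S ?W (Reidx P (inst (T, B, \<alpha>)) \<alpha>)"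
    unfolding henkin_imp_def prod.case by (rule Reidx_himp[OF w hp(6,7)])
  also have "wkf S ?W (wkf ?W T (ex P (ext_fst T B) \<alpha>)) = wkf S T (ex P (ext_fst T B) \<alpha>)"
    by (rule wkf_wkf[OF S(1) WS _ hp(5)]) auto
  also have "\<dots> = wkf S S' (ex P (wk S S') a)"
    unfolding BC by (rule wkf_wkf[OF S(1) S'(6,3) hp(5), symmetric])
  also have "wkf S ?W (Reidx P (inst (T, B, \<alpha>)) \<alpha>) = a"
    unfolding a_def h_def by (rule Reidx_Comp[OF w i hp(3), symmetric])
  finally have imp: "wkf S ?W (henkin_imp (T, B, \<alpha>)) = wkf S S' (ex P (wk S S') a) \<rightarrow>\<^bsub>ctx S\<^esub> a" .
  have zz: "wkf S S' (wkf S' U z) = wkf S U z" by (rule wkf_wkf[OF S(1) S'(6,2) z])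
  show ?thesis
    using henkin_conservative[OF prod z' a] le[unfolded x_eq] unfolding imp zz by blast
qed

text \<open>Formulas are added in order of increasing level of their contexts. The new witness then
  occurs in no earlier context, so \<open>henkin_axiom_conservative\<close> applies at each step;
  \<open>z\<close> accumulates the conjunction of the axioms.\<close>

lemma henkin_axioms_consistent:
  assumes "finite \<Psi>" "\<Psi> \<subseteq> ex_formulas"
  shows "\<exists>z. ((\<Union>x\<in>\<Psi>. wctx x), z) \<in> formulas \<and> consistent ((\<Union>x\<in>\<Psi>. wctx x), z) \<and>
    (\<forall>x\<in>\<Psi>. entails ((\<Union>x\<in>\<Psi>. wctx x), z) (henkin_axiom x))"
  using assms
proof (induction \<Psi> rule: finite_ranking_induct[where f = "\<lambda>x. level (fst x)"])
  case empty
  have X: "ctx {} \<in> Obj (Base P)" by (rule ctx_Obj) simp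
  \<comment> \<open>Top stays top under weakening, so the fibre over each context has to be
    non-trivial.\<close>
  have "consistent ({}, fib_top (ctx {}))"
    using non_trivial[OF ctx_Obj] Reidx_top[OF wk_Hom[of _ "{}"]] by (simp add: consistent_def)
  then show ?case using top_closed[OF X] by (auto simp: formulas_def)
next
  case (insert x \<Psi>)
  let ?D = "\<lambda>\<Psi>. \<Union>x\<in>\<Psi>. wctx x"
  show ?case
  \<comment> \<open>The ranking induction may insert an element that is already present;
    distinctness is needed for freshness.\<close>
  proof (cases "x \<in> \<Psi>")
    case True
    then have "insert x \<Psi> = \<Psi>" by auto
    then show ?thesis using insert by simp
  next
    case False
    obtain z where z: "(?D \<Psi>, z) \<in> formulas" "consistent (?D \<Psi>, z)"
      "\<And>y. y \<in> \<Psi> \<Longrightarrow> entails (?D \<Psi>, z) (henkin_axiom y)"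
      using insert by auto
    have ex: "x \<in> ex_formulas" using insert.prems by simp
    obtain T B \<alpha> where x_eq: "x = (T, B, \<alpha>)" by (cases x) auto
    then have T: "finite (fst x)" and W: "finite (wctx x)" and imp: "henkin_imp x \<in> fib (ctx (wctx x))"
      using henkin_parts[of T B \<alpha>] ex by auto
    let ?c = "wit x" and ?V = "?D \<Psi>" and ?W = "wctx x" and ?V' = "?D (insert x \<Psi>)"
    \<comment> \<open>The context of \<open>z\<close> enlarged by that of \<open>x\<close>, but not
      by the new witness, as conservativity requires.\<close>
    define U where "U = ?V \<union> fst x"
    have V: "finite ?V" "z \<in> fib (ctx ?V)" using z(1) by (auto simp: formulas_def)
    have U: "finite U" "fst x \<subseteq> U" "?V \<subseteq> U" using V T by (auto simp: U_def)
    have V': "finite ?V'" "U \<subseteq> ?V'" "?W \<subseteq> ?V'" "?V \<subseteq> ?V'" using V T by (auto simp: U_def)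
    have fresh: "?c \<notin> U"
    proof
      assume "?c \<in> U"
      \<comment> \<open>The witness is above its own context, differs from the other witnesses by
        injectivity of the code, and is above the other contexts because their levels are not
        larger.\<close>
      then consider "?c \<in> fst x" | y where "y \<in> \<Psi>" "?c = wit y" | y where "y \<in> \<Psi>" "?c \<in> fst y"
        by (auto simp: U_def)
      then show False
      proof cases
        case 1
        then show ?thesis using wit_fresh[OF T order_refl] by (simp add: x_eq)
      next
        case (2 y)
        then show ?thesis using wit_inj[of x y] insert.prems False by auto
      next
        case (3 y)
        obtain T' B' \<alpha>' where y: "y = (T', B', \<alpha>')" by (cases y) auto
        have "finite T'" using henkin_parts(1)[of T' B' \<alpha>'] 3 insert.prems y by auto
        then show ?thesis using wit_fresh[of T' T B \<alpha>] insert.hyps(2)[OF 3(1)] 3(2) x_eq y by simp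
      qed
    qed
    define w where "w = wkf ?V' ?V z \<and>\<^bsub>ctx ?V'\<^esub> wkf ?V' ?W (henkin_imp x)"
    have cl: "wkf ?V' ?V z \<in> fib (ctx ?V')" "wkf ?V' ?W (henkin_imp x) \<in> fib (ctx ?V')"
      using wkf_closed[OF V'(1,4) V(2)] wkf_closed[OF V'(1,3) imp] by blast+
    have X': "ctx ?V' \<in> Obj (Base P)" by (rule ctx_Obj[OF V'(1)])
    have w: "w \<in> fib (ctx ?V')" unfolding w_def by (rule meet_closed[OF X' cl])
    have fml: "(?V', w) \<in> formulas" "(?V', wkf ?V' ?V z) \<in> formulas"
      "(?V', wkf ?V' ?W (henkin_imp x)) \<in> formulas" using w cl V'(1) by (auto simp: formulas_def)
    have axiom_fml: "henkin_axiom y \<in> formulas" if "y \<in> insert x \<Psi>" for y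
      using that insert.prems henkin_axiom_formula by blast
    have "entails (?V', w) (?V', wkf ?V' ?V z)"
      by (rule entails_of_le[OF V'(1) w cl(1) meet_le1[OF X' cl, folded w_def]])
    then have wz: "entails (?V', w) (?V, z)"
      using entails_trans entails_iff_wkf(2)[OF V'(1,4) V(2)] fml z(1) by blast
    have "entails (?V', w) (?V', wkf ?V' ?W (henkin_imp x))"
      by (rule entails_of_le[OF V'(1) w cl(2) meet_le2[OF X' cl, folded w_def]])
    moreover have "entails (?V', wkf ?V' ?W (henkin_imp x)) (henkin_axiom x)"
      unfolding henkin_axiom_def by (rule entails_iff_wkf(2)[OF V'(1,3) imp])
    ultimately have wx: "entails (?V', w) (henkin_axiom x)"
      using entails_trans fml axiom_fml by blast
    have "consistent (?V', w)"
      unfolding consistent_def fst_conv snd_conv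
    proof (intro allI impI notI)
      fix S assume S: "finite S" "?V' \<subseteq> S" and le: "wkf S ?V' w \<preceq>\<^bsub>ctx S\<^esub> fib_bot (ctx S)"
      have sub: "U \<subseteq> S" "?W \<subseteq> S" "?V \<subseteq> S" by (rule order_trans[OF _ S(2)], rule V')+
      \<comment> \<open>An inconsistency of \<open>w\<close> over \<open>S\<close> is split into the
        parts of \<open>z\<close> and of the axiom; conservativity removes the axiom and leaves one
        of \<open>z\<close>.\<close>
      have "wkf S ?V' w = wkf S ?V' (wkf ?V' ?V z) \<and>\<^bsub>ctx S\<^esub> wkf S ?V' (wkf ?V' ?W (henkin_imp x))"
        unfolding w_def by (rule Reidx_meet[OF wk_Hom[OF S] cl])
      also have "wkf S ?V' (wkf ?V' ?V z) = wkf S ?V z" by (rule wkf_wkf[OF S V'(4) V(2)])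
      also have "\<dots> = wkf S U (wkf U ?V z)" by (rule wkf_wkf[OF S(1) sub(1) U(3) V(2), symmetric])
      also have "wkf S ?V' (wkf ?V' ?W (henkin_imp x)) = wkf S ?W (henkin_imp x)"
        by (rule wkf_wkf[OF S V'(3) imp])
      finally have "wkf S U (wkf U ?V z) \<preceq>\<^bsub>ctx S\<^esub> fib_bot (ctx S)"
        using henkin_axiom_conservative[OF ex U(1,2) fresh wkf_closed[OF U(1,3) V(2)] S(1) sub(1,2)]
          le by simp
      then have "wkf S ?V z \<preceq>\<^bsub>ctx S\<^esub> fib_bot (ctx S)" by (simp only: wkf_wkf[OF S(1) sub(1) U(3) V(2)])
      then show False using z(2)[unfolded consistent_def fst_conv snd_conv] S(1) sub(3) by blast
    qed
    moreover have "\<forall>y\<in>insert x \<Psi>. entails (?V', w) (henkin_axiom y)"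
      using wx entails_trans[OF wz z(3) fml(1) z(1) axiom_fml] by blast
    ultimately show ?thesis using fml(1) by blast
  qed
qed

lemma henkin_axioms_compatible: "compatible formulas entails consistent (henkin_axiom ` ex_formulas)"
  unfolding compatible_def
proof (intro conjI allI impI)
  show "henkin_axiom ` ex_formulas \<subseteq> formulas" using henkin_axiom_formula by blast
  fix \<Delta> assume "\<Delta> \<subseteq> henkin_axiom ` ex_formulas" "finite \<Delta>"
  then obtain \<Psi> where \<Psi>: "\<Psi> \<subseteq> ex_formulas" "finite \<Psi>" "\<Delta> = henkin_axiom ` \<Psi>"
    by (meson finite_subset_image)
  then show "\<exists>z\<in>formulas. consistent z \<and> (\<forall>y\<in>\<Delta>. entails z y)"
    using henkin_axioms_consistent[OF \<Psi>(2,1)] by blast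
qed

text \<open>The witness constant for the existential closure of top over \<open>B\<close> has sort
  \<open>B\<close>, and its variable is the required term.\<close>

lemma sort_inhabited:
  assumes B: "B \<in> Obj (Base P)"
  shows "\<exists>T t. finite T \<and> t \<in> Hm (ctx T) B"
proof -
  have "ext {} B \<in> Obj (Base P)" using base.product_Obj(1)[OF ext_product[OF _ B]] by blast
  then have "({}, B, fib_top (ext {} B)) \<in> ex_formulas" using B by (simp add: ex_formulas_def top_closed)
  then have "\<sigma> (wit ({}, B, fib_top (ext {} B))) = B" by (rule sort_wit)
  then have "var {wit ({}, B, fib_top (ext {} B))} (wit ({}, B, fib_top (ext {} B)))
      \<in> Hm (ctx {wit ({}, B, fib_top (ext {} B))}) B"
    using var_Hom[of "{wit ({}, B, fib_top (ext {} B))}" "wit ({}, B, fib_top (ext {} B))"] by simp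
  then show ?thesis by (meson finite.emptyI finite.insertI)
qed

text \<open>The comparison \<open>k\<close> from the chosen cone transports \<alpha>, and
  Beck-Chevalley over an identity shows that both cones give the same existential formula. Its
  Henkin axiom and modus ponens in \<Gamma> then provide the instance.\<close>

lemma henkin_witness:
  assumes \<Gamma>: "complete_theory P \<sigma> \<Gamma>" "henkin_axiom ` ex_formulas \<subseteq> \<Gamma>"
    and T: "finite T" and X: "is_product (Base P) X (ctx T) B p q" and \<alpha>: "\<alpha> \<in> fib X"
    and mem: "(T, ex P p \<alpha>) \<in> \<Gamma>"
  shows "\<exists>S s. finite S \<and> T \<subseteq> S \<and> s \<in> Hm (ctx S) X \<and> p \<cdot> s = wk S T \<and> (S, Reidx P s \<alpha>) \<in> \<Gamma>"
proof -
  interpret complete_theory P \<sigma> \<Gamma> by fact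
  have B: "B \<in> Obj (Base P)" using base.product_Obj[OF X] by simp
  have Z: "is_product (Base P) (ext T B) (ctx T) B (ext_fst T B) (ext_snd T B)"
    using T B by (rule ext_product)
  have p: "p \<in> Hm X (ctx T)" using X by (simp add: is_product_def)
  have pq: "ext_fst T B \<in> Hm (ext T B) (ctx T)" "ext_snd T B \<in> Hm (ext T B) B"
    using Z by (auto simp: is_product_def)
  obtain k where k: "k \<in> Hm (ext T B) X" "p \<cdot> k = ext_fst T B" "q \<cdot> k = ext_snd T B"
    using base.product_pair[OF X pq] by blast
  define \<beta> where "\<beta> = Reidx P k \<alpha>"
  have I: "Ide (Base P) (ctx T) \<in> Hm (ctx T) (ctx T)" by (rule base.Ide_Hom[OF ctx_Obj[OF T]])
  \<comment> \<open>Beck-Chevalley expects a base arrow on the right, here the identity of the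
    context.\<close>
  have "p \<cdot> k = Ide (Base P) (ctx T) \<cdot> ext_fst T B" using base.Comp_Ide_left[OF pq(1)] k(2) by simp
  from Beck_Chevalley[OF Z X I k(1) this k(3) \<alpha>]
  have eq: "ex P (ext_fst T B) \<beta> = ex P p \<alpha>"
    using Reidx_Ide[OF ctx_Obj[OF T] ex_closed[OF X \<alpha>]] by (simp add: \<beta>_def)
  have "\<beta> \<in> fib (ext T B)" unfolding \<beta>_def using k(1) \<alpha> by (rule Reidx_mem)
  then have x: "(T, B, \<beta>) \<in> ex_formulas" using T B by (simp add: ex_formulas_def)
  note hp = henkin_parts[OF x]
  let ?W = "wctx (T, B, \<beta>)"
  have TW: "T \<subseteq> ?W" by auto
  have "henkin_axiom (T, B, \<beta>) \<in> \<Gamma>" using \<Gamma>(2) x by blast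
  then have "(?W, wkf ?W T (ex P (ext_fst T B) \<beta>) \<rightarrow>\<^bsub>ctx ?W\<^esub> Reidx P (inst (T, B, \<beta>)) \<beta>) \<in> \<Gamma>"
    by (simp add: henkin_axiom_def henkin_imp_def)
  moreover have "(?W, wkf ?W T (ex P (ext_fst T B) \<beta>)) \<in> \<Gamma>"
    using \<Gamma>_wkf_iff[OF hp(4) TW hp(5)] mem eq by simp
  ultimately have "(?W, Reidx P (inst (T, B, \<beta>)) \<beta>) \<in> \<Gamma>"
    using \<Gamma>_imp_iff[OF hp(4,6,7)] by simp
  then have "(?W, Reidx P (k \<cdot> inst (T, B, \<beta>)) \<alpha>) \<in> \<Gamma>"
    using Reidx_Comp[OF inst_Hom[OF x] k(1) \<alpha>] by (simp add: \<beta>_def)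
  moreover have "p \<cdot> (k \<cdot> inst (T, B, \<beta>)) = wk ?W T"
    using base.Comp_assoc[OF inst_Hom[OF x] k(1) p] k(2) ext_fst_inst[OF x] by simp
  moreover have "k \<cdot> inst (T, B, \<beta>) \<in> Hm (ctx ?W) X"
    using inst_Hom[OF x] k(1) by (rule base.Comp_Hom)
  ultimately show ?thesis using hp(4) TW by blast
qed

end

theorem theorem4p16:
  fixes P :: "('o, 'a, 'p) doctrine"
  assumes "bounded_doctrine P"
    and "existential_doctrine P"
    and "implicational_doctrine P"
    and non_trivial_fibres: "\<forall>A\<in>Obj (Base P). \<not> is_singleton (carrier (Fib P A))"
    and universe: "infinite (UNIV :: 'u set)"
    and small_base: "Obj (Base P) \<lesssim> (UNIV :: 'u set)" "Arr (Base P) \<lesssim> (UNIV :: 'u set)"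
    and small_fibres: "\<forall>A\<in>Obj (Base P). carrier (Fib P A) \<lesssim> (UNIV :: 'u set)"
  shows "\<exists>M :: ('o, 'a, 'p, 'u set, 'u set_arrow, 'u set) morphism.
           bounded_morphism P subsets_doctrine M \<and>
           existential_morphism P subsets_doctrine M \<and>
           implicational_morphism P subsets_doctrine M"
proof -
  interpret heyting_doctrine P
    using assms(1-3) by (intro heyting_doctrine.intro)
  have non_trivial: "\<not> fib_top A \<preceq>\<^bsub>A\<^esub> fib_bot A" if A: "A \<in> Obj (Base P)" for A
  proof
    assume le: "fib_top A \<preceq>\<^bsub>A\<^esub> fib_bot A"
    have "x = fib_top A" if x: "x \<in> fib A" for x
    proof (rule fib_antisym[OF A le_top[OF A x] _ x top_closed[OF A]])
      show "fib_top A \<preceq>\<^bsub>A\<^esub> x"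
        using le bot_le[OF A x] top_closed[OF A] bot_closed[OF A] x by (rule fib_trans[OF A])
    qed
    then have "fib A = {fib_top A}" using top_closed[OF A] by blast
    then show False using non_trivial_fibres A by (auto simp: is_singleton_def)
  qed
  let ?K = "UNIV :: (nat \<times> 'u) set"
  \<comment> \<open>There are no more constants than elements of the universe, hence no more
    contexts either.\<close>
  have "(UNIV :: nat set) \<times> (UNIV :: 'u set) \<lesssim> (UNIV :: 'u set)"
    using universe by (intro Sigma_lepoll_infinite) (simp_all flip: infinite_le_lepoll)
  then have "{T. T \<subseteq> ?K \<and> finite T} \<lesssim> (UNIV :: 'u set)"
    by (intro finite_subsets_lepoll_infinite universe) simp
  then have fin: "{T :: (nat \<times> 'u) set. finite T} \<lesssim> (UNIV :: 'u set)" by simp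
  \<comment> \<open>The third component ranges over all objects: the product of a context with a
    sort depends on the sorts of the constants, which are not yet defined.\<close>
  let ?D = "{T :: (nat \<times> 'u) set. finite T} \<times> Obj (Base P) \<times> Sigma (Obj (Base P)) fib"
  have "?D \<lesssim> (UNIV :: 'u set)"
    using small_base small_fibres by (intro Sigma_lepoll_infinite universe fin) auto
  then obtain g :: "_ \<Rightarrow> 'u" where g: "inj_on g ?D" by (auto simp: lepoll_def)
  \<comment> \<open>A second code, for terms; it provides the elements of the model, while
    \<open>g\<close> only names the constants.\<close>
  have "{T :: (nat \<times> 'u) set. finite T} \<times> Arr (Base P) \<lesssim> (UNIV :: 'u set)"
    using small_base by (intro Sigma_lepoll_infinite universe fin) auto
  then obtain code :: "_ \<Rightarrow> 'u" where code: "inj_on code ({T :: (nat \<times> 'u) set. finite T} \<times> Arr (Base P))"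
    by (auto simp: lepoll_def)
  obtain I where I: "I \<in> Obj (Base P)" using base.terminal_exists by (auto simp: is_terminal_def)
  \<comment> \<open>The sort of a constant is the component \<open>B\<close> of the tuple that it
    codes; \<open>I\<close> is a default for elements of the universe that code nothing.\<close>
  define \<sigma> :: "nat \<times> 'u \<Rightarrow> 'o" where
    "\<sigma> = (\<lambda>(n, u). if u \<in> g ` ?D then fst (snd (inv_into ?D g u)) else I)"
  have \<sigma>_Obj: "\<sigma> c \<in> Obj (Base P)" for c
  proof (cases "snd c \<in> g ` ?D")
    case True
    then have "inv_into ?D g (snd c) \<in> ?D" by (rule inv_into_into)
    then show ?thesis using True by (auto simp: \<sigma>_def split_beta)
  qed (auto simp: \<sigma>_def split_beta I)
  interpret henkin_constants P \<sigma> g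
  proof
    show "\<sigma> c \<in> Obj (Base P)" for c by (rule \<sigma>_Obj)
    show "inj_on g ?D" by (rule g)
    show "\<sigma> (n, g (T, B, Z, \<alpha>)) = B"
      if "finite T" "B \<in> Obj (Base P)" "Z \<in> Obj (Base P)" "\<alpha> \<in> fib Z" for T B Z \<alpha> n
    proof -
      have mem: "(T, B, Z, \<alpha>) \<in> ?D" using that by simp
      show ?thesis using imageI[OF mem, of g] inv_into_f_f[OF g mem] by (simp only: \<sigma>_def prod.case if_True fst_conv snd_conv)
    qed
  qed (rule non_trivial)
  obtain \<Gamma> where \<Gamma>: "henkin_axiom ` ex_formulas \<subseteq> \<Gamma>" "complete_theory P \<sigma> \<Gamma>"
    using complete_theory_exists[OF henkin_axioms_compatible] by blast
  interpret henkin_theory P \<sigma> \<Gamma> code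
    by (intro henkin_theory.intro henkin_theory_axioms.intro \<Gamma>(2) universe code sort_inhabited
        henkin_witness[OF \<Gamma>(2,1)])
  show ?thesis
    using bounded_morphism_model existential_morphism_model implicational_morphism_model by blast
qed

end
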